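(* Let $G$ be a finitely generated group. Then the commutator subgroup $F'$ consists of weak* identities in $G$ modulo $F''$.
   Context: Let $F$ be the free group on countably many generators $g_1,g_2,\dots$; $F'=[F,F]$ and $F''=[F',F']$. For $N\ge 1$, $F^{\times N}$ is the direct product of $N$ copies of $F$, $i_k:F\to F^{\times N}$ the $k$-th inclusion. A subset $S\subset F$ is a set of weak identities in a group $G$ if there exists $N\ge1$ such that for any $s_1,\dots,s_N\in S$ and any homomorphism $\rho:F^{\times N}\to G$ some $k$ has $\rho(i_k(s_k))=1$. A $T$-subgroup of $F$ is a subgroup preserved by all endomorphisms of $F$. For a $T$-subgroup $\mathcal{H}$, $\mathcal{H}(G)=\{\pi(h):h\in\mathcal{H},\ \pi:F\to G\text{ a homomorphism}\}$ (a normal subgroup of $G$). $S$ consists of weak identities modulo $\mathcal{H}$ in $G$ if $S$ is a set of weak identities in $G/\mathcal{H}(G)$. A $T$-subgroup $\mathcal{S}$ consists of weak* identities in $G$ modulo a $T$-subgroup $\mathcal{H}$ if there exist an integer $m\ge0$ and $T$-subgroups $\mathcal{S}_0=\mathcal{S},\dots,\mathcal{S}_m=\mathcal{H}$ such that $\mathcal{S}_{j-1}$ consists of weak identities modulo $\mathcal{S}_j$ in $G$ for all $j=1,\dots,m$. *)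

theory Defs
  imports "HOL-Algebra.Algebra"
begin

text \<open>Words are lists of letters (i, b): generator number i, with b = True meaning
  the inverse letter. Elements of F are the freely reduced words.\<close>

type_synonym fword = "(nat \<times> bool) list"

fun cons_red :: "nat \<times> bool \<Rightarrow> fword \<Rightarrow> fword" where
  "cons_red a [] = [a]"
| "cons_red a (b # w) = (if fst a = fst b \<and> snd a \<noteq> snd b then w else a # b # w)"

fun reduce :: "fword \<Rightarrow> fword" where
  "reduce [] = []"
| "reduce (a # w) = cons_red a (reduce w)"

definition FreeGroup :: "fword monoid" where
  "FreeGroup = \<lparr>carrier = {w. reduce w = w}, monoid.mult = (\<lambda>x y. reduce (x @ y)), one = []\<rparr>"

definition FPow :: "nat \<Rightarrow> (nat \<Rightarrow> fword) monoid" where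
  "FPow N = product_group {..<N} (\<lambda>_. FreeGroup)"

definition incl :: "nat \<Rightarrow> nat \<Rightarrow> fword \<Rightarrow> (nat \<Rightarrow> fword)" where
  "incl N k x = (\<lambda>j\<in>{..<N}. if j = k then x else [])"

definition T_subgroup :: "fword set \<Rightarrow> bool" where
  "T_subgroup H \<longleftrightarrow> subgroup H FreeGroup \<and>
     (\<forall>\<phi> \<in> hom FreeGroup FreeGroup. \<phi> ` H \<subseteq> H)"

definition verbal :: "fword set \<Rightarrow> ('g, 'b) monoid_scheme \<Rightarrow> 'g set" where
  "verbal H G = {\<pi> h | h \<pi>. h \<in> H \<and> \<pi> \<in> hom FreeGroup G}"

definition weak_identities :: "fword set \<Rightarrow> ('g, 'b) monoid_scheme \<Rightarrow> bool" where
  "weak_identities S G \<longleftrightarrow>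
     (\<exists>N::nat. N \<ge> 1 \<and>
        (\<forall>s \<in> {..<N} \<rightarrow> S. \<forall>\<rho> \<in> hom (FPow N) G.
           \<exists>k<N. \<rho> (incl N k (s k)) = \<one>\<^bsub>G\<^esub>))"

definition weak_identities_mod :: "fword set \<Rightarrow> fword set \<Rightarrow> ('g, 'b) monoid_scheme \<Rightarrow> bool" where
  "weak_identities_mod S H G \<longleftrightarrow> weak_identities S (G Mod (verbal H G))"

definition weak_star_mod :: "fword set \<Rightarrow> fword set \<Rightarrow> ('g, 'b) monoid_scheme \<Rightarrow> bool" where
  "weak_star_mod S H G \<longleftrightarrow>
     (\<exists>(m::nat) (Ss :: nat \<Rightarrow> fword set).
        Ss 0 = S \<and> Ss m = H \<and> (\<forall>j\<le>m. T_subgroup (Ss j)) \<and>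
        (\<forall>j\<in>{1..m}. weak_identities_mod (Ss (j - 1)) (Ss j) G))"

definition finitely_generated :: "('g, 'b) monoid_scheme \<Rightarrow> bool" where
  "finitely_generated G \<longleftrightarrow> (\<exists>A. finite A \<and> A \<subseteq> carrier G \<and> generate G A = carrier G)"

end

theory Submission
  imports Defs
begin

text \<open>A homomorphism from \<open>F\<^sup>N\<close> to \<open>M\<close> amounts to \<open>N\<close> pairwise commuting subgroups \<open>H\<^sub>k\<close> of \<open>M\<close>,
  and the chain from \<open>F'\<close> to \<open>F''\<close> consists of the groups \<open>\<gamma>\<^sub>n(F)F''\<close>.

  Let \<open>M\<close> be finitely generated and metabelian. By P. Hall, \<open>M\<close> satisfies the maximal condition on normal
  subgroups, so by Noetherian induction one may assume that two nontrivial normal subgroups always meet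
  nontrivially. Then \<open>a \<mapsto> [q, a]\<close> is injective or nilpotent on \<open>M'\<close> for each \<open>q\<close>. If \<open>H\<^sub>0\<close> and \<open>H\<^sub>1\<close>
  commute and are both nonabelian, then \<open>H\<^sub>0\<close> centralises a nontrivial element of \<open>M'\<close>, hence acts
  nilpotently on \<open>M'\<close>, with a bound that depends only on \<open>M\<close>. So \<open>\<gamma>\<^sub>c(F)F''\<close> consists of weak identities
  modulo \<open>F''\<close> for some \<open>c\<close>.

  If moreover \<open>\<gamma>\<^sub>d\<^sub>+\<^sub>1(M) = 1\<close> and \<open>\<gamma>\<^sub>d(H\<^sub>k) \<noteq> 1\<close> for all \<open>k\<close>, the same reduction yields \<open>b \<noteq> 1\<close> and
  \<open>w\<^sub>k, v\<^sub>k \<in> H\<^sub>k\<close> with \<open>[w\<^sub>k, v\<^sub>k] = b\<close> and \<open>[w\<^sub>k, v\<^sub>l] = 1\<close> for \<open>k \<noteq> l\<close>. As \<open>[\<cdot>, v\<^sub>l]\<close> is a homomorphism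
  to the centre, an integer relation between the images of the \<open>w\<^sub>k\<close> in the abelianisation bounds their number
  by the number of generators of \<open>M\<close>.\<close>

section \<open>Commutator subgroups\<close>

text \<open>A direct product such as S3 x S3 contains two commuting subgroups that are not
  nilpotent, so comparing just two subgroups cannot work in \<open>M\<close> itself. Irreducibility
  removes this obstacle: a single nontrivial fixed element of \<open>q\<close> in M' then controls
  the action of \<open>q\<close> on the whole of M', and in the nilpotent stage the nontrivial
  central commutators coming from different H_k acquire a common nontrivial power, which makes them
  comparable. The price is paid on the way back: each intersection of two normal subgroups adds the
  two numbers of subgroups and takes the larger class. The larger class is harmless in the first
  stage, where the class is unknown, and no change in the second, where it is prescribed. In an
  irreducible quotient two subgroups suffice in the first stage, and one more than the number of
  generators in the second. Since b may have finite order, a nonzero integer relation is not enough: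
  some coefficient must avoid a prime divisor of that order.\<close>

definition commutator :: "('a, 'b) monoid_scheme \<Rightarrow> 'a \<Rightarrow> 'a \<Rightarrow> 'a" where
  "commutator G x y = x \<otimes>\<^bsub>G\<^esub> y \<otimes>\<^bsub>G\<^esub> inv\<^bsub>G\<^esub> x \<otimes>\<^bsub>G\<^esub> inv\<^bsub>G\<^esub> y"

definition commutator_subgroup :: "('a, 'b) monoid_scheme \<Rightarrow> 'a set \<Rightarrow> 'a set \<Rightarrow> 'a set" where
  "commutator_subgroup G H K = generate G {commutator G h k | h k. h \<in> H \<and> k \<in> K}"

text \<open>The index starts at 0, so stage \<open>n\<close> is the usual \<gamma>_{n+1}(H).
  Commutators are formed in the ambient group, which allows comparing the series of a subgroup with
  that of \<open>G\<close> without changing the group.\<close>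

primrec lower_central :: "('a, 'b) monoid_scheme \<Rightarrow> 'a set \<Rightarrow> nat \<Rightarrow> 'a set" where
  "lower_central G H 0 = H"
| "lower_central G H (Suc n) = commutator_subgroup G H (lower_central G H n)"

lemma derived_eq_commutator_subgroup: "derived G H = commutator_subgroup G H H"
proof -
  have "(\<Union>h1\<in>H. \<Union>h2\<in>H. {h1 \<otimes>\<^bsub>G\<^esub> h2 \<otimes>\<^bsub>G\<^esub> inv\<^bsub>G\<^esub> h1 \<otimes>\<^bsub>G\<^esub> inv\<^bsub>G\<^esub> h2})
      = {commutator G h k | h k. h \<in> H \<and> k \<in> H}"
    by (auto simp: commutator_def)
  then show ?thesis by (simp add: derived_def commutator_subgroup_def)
qed

lemma lower_central_1: "lower_central G H (Suc 0) = derived G H"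
  by (simp add: derived_eq_commutator_subgroup)

context group
begin

lemma mult_inv_cancel [simp]:
  "\<lbrakk>x \<in> carrier G; y \<in> carrier G\<rbrakk> \<Longrightarrow> x \<otimes> (inv x \<otimes> y) = y"
  "\<lbrakk>x \<in> carrier G; y \<in> carrier G\<rbrakk> \<Longrightarrow> inv x \<otimes> (x \<otimes> y) = y"
  by (simp_all add: m_assoc [symmetric])

lemma commutator_closed [simp, intro]:
  "\<lbrakk>x \<in> carrier G; y \<in> carrier G\<rbrakk> \<Longrightarrow> commutator G x y \<in> carrier G"
  by (simp add: commutator_def)

lemma commutator_eq_one_iff:
  assumes "x \<in> carrier G" "y \<in> carrier G"
  shows "commutator G x y = \<one> \<longleftrightarrow> x \<otimes> y = y \<otimes> x"
proof -
  have "commutator G x y = (x \<otimes> y) \<otimes> inv (y \<otimes> x)"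
    using assms by (simp add: commutator_def inv_mult_group m_assoc)
  moreover have "(x \<otimes> y) \<otimes> inv (y \<otimes> x) = \<one> \<longleftrightarrow> x \<otimes> y = \<one> \<otimes> (y \<otimes> x)"
    using assms by (metis inv_solve_right' m_closed one_closed)
  ultimately show ?thesis using assms by simp
qed

lemma commutator_in_subgroup:
  "\<lbrakk>subgroup H G; x \<in> H; y \<in> H\<rbrakk> \<Longrightarrow> commutator G x y \<in> H"
  unfolding commutator_def by (auto intro!: subgroup.m_closed subgroup.m_inv_closed)

lemma commutator_subgroup_is_subgroup:
  assumes "H \<subseteq> carrier G" "K \<subseteq> carrier G"
  shows "subgroup (commutator_subgroup G H K) G"
  unfolding commutator_subgroup_def using assms by (intro generate_is_subgroup) auto

lemma commutator_subgroup_least: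
  assumes "subgroup L G" "\<And>h k. \<lbrakk>h \<in> H; k \<in> K\<rbrakk> \<Longrightarrow> commutator G h k \<in> L"
  shows "commutator_subgroup G H K \<subseteq> L"
  unfolding commutator_subgroup_def using assms by (intro generate_subgroup_incl) auto

lemma commutator_in_commutator_subgroup:
  "\<lbrakk>h \<in> H; k \<in> K\<rbrakk> \<Longrightarrow> commutator G h k \<in> commutator_subgroup G H K"
  unfolding commutator_subgroup_def by (intro generate.incl) auto

lemma commutator_subgroup_mono:
  "\<lbrakk>H \<subseteq> H'; K \<subseteq> K'\<rbrakk> \<Longrightarrow> commutator_subgroup G H K \<subseteq> commutator_subgroup G H' K'"
  unfolding commutator_subgroup_def by (intro mono_generate) auto

lemma lower_central_is_subgroup:
  "subgroup H G \<Longrightarrow> subgroup (lower_central G H n) G"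
  by (induction n) (auto intro!: commutator_subgroup_is_subgroup dest: subgroup.subset)

lemma lower_central_Suc_subset:
  assumes "subgroup H G" shows "lower_central G H (Suc n) \<subseteq> lower_central G H n"
proof (induction n)
  case 0
  show ?case using commutator_subgroup_least[OF assms] commutator_in_subgroup[OF assms] by simp
next
  case (Suc n)
  then show ?case by (simp add: commutator_subgroup_mono)
qed

lemma lower_central_antimono:
  "\<lbrakk>subgroup H G; m \<le> n\<rbrakk> \<Longrightarrow> lower_central G H n \<subseteq> lower_central G H m"
  by (rule lift_Suc_antimono_le[of "lower_central G H"]) (rule lower_central_Suc_subset)

lemma lower_central_mono:
  "H \<subseteq> K \<Longrightarrow> lower_central G H n \<subseteq> lower_central G K n"
  by (induction n) (simp_all add: commutator_subgroup_mono)

text \<open>The conjugate of h by g is [g, h] h.\<close>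

lemma derived_subset_normal:
  assumes "subgroup H G" "derived G (carrier G) \<subseteq> H" shows "H \<lhd> G"
proof (rule normal_invI[OF assms(1)])
  fix g h assume g: "g \<in> carrier G" and h: "h \<in> H"
  have hc: "h \<in> carrier G" using assms(1) h by (meson subgroup.mem_carrier)
  have "commutator G g h \<in> H"
    using assms(2) g hc commutator_in_commutator_subgroup[of g "carrier G" h "carrier G"]
    by (auto simp: derived_eq_commutator_subgroup)
  then have "commutator G g h \<otimes> h \<in> H" using assms(1) h by (simp add: subgroup.m_closed)
  moreover have "commutator G g h \<otimes> h = g \<otimes> h \<otimes> inv g"
    using g hc by (simp add: commutator_def m_assoc)
  ultimately show "g \<otimes> h \<otimes> inv g \<in> H" by simp
qed

end

context group_hom
begin

lemma hom_commutator:
  "\<lbrakk>x \<in> carrier G; y \<in> carrier G\<rbrakk> \<Longrightarrow> h (commutator G x y) = commutator H (h x) (h y)"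
  by (simp add: commutator_def)

lemma commutator_subgroup_img:
  assumes "A \<subseteq> carrier G" "B \<subseteq> carrier G"
  shows "h ` commutator_subgroup G A B = commutator_subgroup H (h ` A) (h ` B)"
proof -
  have "h ` {commutator G a b | a b. a \<in> A \<and> b \<in> B}
      = {commutator H a b | a b. a \<in> h ` A \<and> b \<in> h ` B}" (is "h ` ?X = ?Y")
  proof
    show "h ` ?X \<subseteq> ?Y" using assms by (auto simp: hom_commutator subset_iff; blast)
    show "?Y \<subseteq> h ` ?X"
    proof
      fix y assume "y \<in> ?Y"
      then obtain a b where ab: "a \<in> A" "b \<in> B" "y = commutator H (h a) (h b)" by auto
      then have "y = h (commutator G a b)" using assms by (auto simp: hom_commutator subset_iff)
      then show "y \<in> h ` ?X" using ab by blast
    qed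
  qed
  moreover have "?X \<subseteq> carrier G" using assms by auto
  ultimately show ?thesis
    unfolding commutator_subgroup_def using generate_img[of ?X] by simp
qed

lemma lower_central_img:
  assumes "subgroup A G"
  shows "h ` lower_central G A n = lower_central H (h ` A) n"
proof (induction n)
  case (Suc n)
  have "lower_central G A n \<subseteq> carrier G"
    using G.lower_central_is_subgroup[OF assms] by (rule subgroup.subset)
  then show ?case using Suc commutator_subgroup_img[of A "lower_central G A n"] assms
    by (simp add: subgroup.subset)
qed simp

end

section \<open>The free group and verbal subgroups\<close>

definition letter :: "nat \<Rightarrow> fword" where "letter i = [(i, False)]"

fun letter_value :: "('g, 'b) monoid_scheme \<Rightarrow> (nat \<Rightarrow> 'g) \<Rightarrow> nat \<times> bool \<Rightarrow> 'g" where
  "letter_value G f (i, b) = (if b then inv\<^bsub>G\<^esub> f i else f i)"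

primrec word_value :: "('g, 'b) monoid_scheme \<Rightarrow> (nat \<Rightarrow> 'g) \<Rightarrow> fword \<Rightarrow> 'g" where
  "word_value G f [] = \<one>\<^bsub>G\<^esub>"
| "word_value G f (a # w) = letter_value G f a \<otimes>\<^bsub>G\<^esub> word_value G f w"

definition inverse_letter :: "nat \<times> bool \<Rightarrow> nat \<times> bool" where
  "inverse_letter a = (fst a, \<not> snd a)"

text \<open>If the first letter cancelled, \<open>a # w\<close> would be the tail of
  \<open>reduce w\<close>, but reduction never lengthens a word.\<close>

lemma reduced_tl: "reduce (a # w) = a # w \<Longrightarrow> reduce w = w"
proof -
  have len: "length (reduce w) \<le> length w" for w
  proof (induction w)
    case (Cons a w)
    then show ?case by (cases "reduce w") auto
  qed simp
  assume h: "reduce (a # w) = a # w"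
  show "reduce w = w"
  proof (cases "reduce w")
    case Nil
    then show ?thesis using h by simp
  next
    case (Cons b v)
    then have "length v < length w" using len[of w] by simp
    then show ?thesis using h Cons by (auto split: if_splits)
  qed
qed

lemma reduce_cons_red: "reduce w = w \<Longrightarrow> reduce (cons_red a w) = cons_red a w"
proof (cases w)
  case (Cons b v)
  assume "reduce w = w"
  then show ?thesis using Cons reduced_tl[of b v] by auto
qed simp

lemma reduce_idem [simp]: "reduce (reduce w) = reduce w"
  by (induction w) (auto simp: reduce_cons_red)

text \<open>Van der Waerden's device: each letter acts on the reduced words, and the inverse letter
  undoes this action. Reduction of \<open>x @ y\<close> is then the action of the word
  \<open>x\<close> on \<open>reduce y\<close>, and associativity becomes composition of
  maps.\<close>

lemma cons_red_inverse: "reduce w = w \<Longrightarrow> cons_red (inverse_letter a) (cons_red a w) = w"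
proof (cases w)
  case (Cons b v)
  assume w: "reduce w = w"
  show ?thesis
  proof (cases "fst a = fst b \<and> snd a \<noteq> snd b")
    case True
    then have "inverse_letter a = b" by (auto simp: inverse_letter_def prod_eq_iff)
    moreover have "cons_red b v = b # v" using w Cons reduced_tl[of b v] by simp
    ultimately show ?thesis using True Cons by simp
  next
    case False
    then show ?thesis using Cons by (auto simp: inverse_letter_def)
  qed
qed (auto simp: inverse_letter_def)

lemma reduce_append_foldr: "reduce (x @ y) = foldr cons_red x (reduce y)"
  by (induction x) auto

lemma foldr_cons_red: "reduce w = w \<Longrightarrow> reduce (foldr cons_red x w) = foldr cons_red x w"
  by (induction x) (auto simp: reduce_cons_red)

text \<open>In the cancelling case the letter undoes the action of the head of \<open>x\<close>, so
  a cancelled pair acts trivially; hence a word and its reduction act alike.\<close>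

lemma foldr_cons_red_cons_red:
  "\<lbrakk>reduce x = x; reduce y = y\<rbrakk> \<Longrightarrow> foldr cons_red (cons_red a x) y = cons_red a (foldr cons_red x y)"
proof (cases x)
  case (Cons b v)
  assume x: "reduce x = x" and y: "reduce y = y"
  show ?thesis
  proof (cases "fst a = fst b \<and> snd a \<noteq> snd b")
    case True
    then have "a = inverse_letter b" by (auto simp: inverse_letter_def prod_eq_iff)
    then show ?thesis using Cons True cons_red_inverse[of "foldr cons_red v y" b] foldr_cons_red[OF y]
      by simp
  qed (use Cons in auto)
qed simp

lemma reduce_reduce_append: "reduce (reduce x @ y) = reduce (x @ y)"
proof -
  have "foldr cons_red (reduce x) (reduce y) = foldr cons_red x (reduce y)"
    by (induction x) (auto simp: foldr_cons_red_cons_red)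
  then show ?thesis by (simp add: reduce_append_foldr)
qed

lemma reduce_append_reduce: "reduce (x @ reduce y) = reduce (x @ y)"
  by (simp add: reduce_append_foldr)

definition inverse_word :: "fword \<Rightarrow> fword" where
  "inverse_word w = rev (map inverse_letter w)"

lemma inverse_word_append: "reduce (inverse_word w @ w) = []"
proof (induction w)
  case (Cons a w)
  have "reduce (inverse_word (a # w) @ a # w)
      = foldr cons_red (inverse_word w) (cons_red (inverse_letter a) (cons_red a (reduce w)))"
    by (simp add: inverse_word_def reduce_append_foldr)
  also have "\<dots> = reduce (inverse_word w @ w)"
    by (simp add: cons_red_inverse reduce_append_foldr)
  finally show ?case using Cons by simp
qed (simp add: inverse_word_def)

lemma group_FreeGroup: "group FreeGroup"
proof (rule groupI)
  fix x assume "x \<in> carrier FreeGroup"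
  show "\<exists>y\<in>carrier FreeGroup. y \<otimes>\<^bsub>FreeGroup\<^esub> x = \<one>\<^bsub>FreeGroup\<^esub>"
    by (rule bexI[of _ "reduce (inverse_word x)"])
      (auto simp: FreeGroup_def reduce_reduce_append inverse_word_append)
qed (auto simp: FreeGroup_def reduce_reduce_append reduce_append_reduce)

interpretation F: group FreeGroup by (rule group_FreeGroup)

lemma letter_in_carrier [simp]: "letter i \<in> carrier FreeGroup"
  by (simp add: FreeGroup_def letter_def)

context group
begin

lemma letter_value_closed [simp]: "range f \<subseteq> carrier G \<Longrightarrow> letter_value G f a \<in> carrier G"
  by (cases a) auto

lemma word_value_closed [simp]: "range f \<subseteq> carrier G \<Longrightarrow> word_value G f w \<in> carrier G"
  by (induction w) auto

lemma word_value_append: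
  "range f \<subseteq> carrier G \<Longrightarrow> word_value G f (x @ y) = word_value G f x \<otimes> word_value G f y"
  by (induction x) (auto simp: m_assoc)

lemma word_value_reduce: "range f \<subseteq> carrier G \<Longrightarrow> word_value G f (reduce w) = word_value G f w"
proof (induction w)
  case (Cons a w)
  have f: "f i \<in> carrier G" for i using Cons.prems by auto
  have "word_value G f (cons_red a v) = letter_value G f a \<otimes> word_value G f v" for v
  proof (cases v)
    case (Cons b u)
    show ?thesis
    proof (cases "fst a = fst b \<and> snd a \<noteq> snd b")
      case True
      obtain i c where "a = (i, c)" "b = (i, \<not> c)" using True by (cases a; cases b) auto
      moreover have "word_value G f u \<in> carrier G" using \<open>range f \<subseteq> carrier G\<close> by simp
      ultimately show ?thesis using True Cons f by simp
    qed (use Cons in auto)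
  qed simp
  then show ?case using Cons by simp
qed simp

lemma word_value_hom: "range f \<subseteq> carrier G \<Longrightarrow> word_value G f \<in> hom FreeGroup G"
  by (rule homI) (auto simp: FreeGroup_def word_value_reduce word_value_append)

lemma word_value_letter [simp]: "range f \<subseteq> carrier G \<Longrightarrow> word_value G f (letter i) = f i"
  using r_one[of "f i"] by (simp add: letter_def image_subset_iff)

lemma hom_FreeGroup_eqI:
  assumes "\<phi> \<in> hom FreeGroup G" "\<psi> \<in> hom FreeGroup G" "\<And>i. \<phi> (letter i) = \<psi> (letter i)"
    and "w \<in> carrier FreeGroup"
  shows "\<phi> w = \<psi> w"
proof -
  interpret p: group_hom FreeGroup G \<phi> using assms(1) by unfold_locales
  interpret q: group_hom FreeGroup G \<psi> using assms(2) by unfold_locales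
  have "reduce w = w" using assms(4) by (simp add: FreeGroup_def)
  then show ?thesis
  proof (induction w)
    case Nil
    show ?case using p.hom_one q.hom_one by (simp add: FreeGroup_def)
  next
    case (Cons a w)
    have w: "reduce w = w" using Cons.prems by (rule reduced_tl)
    have a: "[a] \<in> carrier FreeGroup" by (simp add: FreeGroup_def)
    have "[(fst a, True)] = inv\<^bsub>FreeGroup\<^esub> letter (fst a)"
      by (rule F.inv_equality[symmetric]) (auto simp: FreeGroup_def letter_def)
    then have "\<phi> [a] = \<psi> [a]"
      using assms(3)[of "fst a"] by (cases a; cases "snd a") (auto simp: letter_def[symmetric])
    moreover have "a # w = [a] \<otimes>\<^bsub>FreeGroup\<^esub> w" using Cons.prems by (simp add: FreeGroup_def)
    moreover have "w \<in> carrier FreeGroup" using w by (simp add: FreeGroup_def)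
    ultimately show ?case using Cons.IH[OF w] a by simp
  qed
qed

end

section \<open>T-subgroups and their values in a group\<close>

lemma T_subgroup_hom: "\<lbrakk>T_subgroup H; \<phi> \<in> hom FreeGroup FreeGroup; h \<in> H\<rbrakk> \<Longrightarrow> \<phi> h \<in> H"
  unfolding T_subgroup_def by auto

lemma T_subgroup_carrier: "T_subgroup (carrier FreeGroup)"
  unfolding T_subgroup_def by (auto simp: F.subgroup_self hom_in_carrier)

lemma T_subgroup_generate:
  assumes "S \<subseteq> carrier FreeGroup" "\<And>\<phi> s. \<lbrakk>\<phi> \<in> hom FreeGroup FreeGroup; s \<in> S\<rbrakk> \<Longrightarrow> \<phi> s \<in> S"
  shows "T_subgroup (generate FreeGroup S)"
  unfolding T_subgroup_def
proof (intro conjI ballI)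
  show "subgroup (generate FreeGroup S) FreeGroup" using assms(1) by (rule F.generate_is_subgroup)
  fix \<phi> assume "\<phi> \<in> hom FreeGroup FreeGroup"
  then interpret group_hom FreeGroup FreeGroup \<phi> by unfold_locales
  have "\<phi> ` S \<subseteq> S" using assms(2) homh by auto
  then show "\<phi> ` generate FreeGroup S \<subseteq> generate FreeGroup S"
    using generate_img[OF assms(1)] F.mono_generate by blast
qed

lemma T_subgroup_commutator_subgroup:
  assumes "T_subgroup H" "T_subgroup K"
  shows "T_subgroup (commutator_subgroup FreeGroup H K)"
  unfolding commutator_subgroup_def
proof (rule T_subgroup_generate)
  have sub: "H \<subseteq> carrier FreeGroup" "K \<subseteq> carrier FreeGroup"
    using assms by (auto simp: T_subgroup_def dest: subgroup.subset)
  then show "{commutator FreeGroup h k |h k. h \<in> H \<and> k \<in> K} \<subseteq> carrier FreeGroup" by auto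
  fix \<phi> s assume phi: "\<phi> \<in> hom FreeGroup FreeGroup" and "s \<in> {commutator FreeGroup h k |h k. h \<in> H \<and> k \<in> K}"
  then obtain h k where s: "s = commutator FreeGroup h k" "h \<in> H" "k \<in> K" by auto
  interpret group_hom FreeGroup FreeGroup \<phi> using phi by unfold_locales
  have "\<phi> s = commutator FreeGroup (\<phi> h) (\<phi> k)" using s sub by (auto simp: hom_commutator subset_iff)
  moreover have "\<phi> h \<in> H" "\<phi> k \<in> K" using T_subgroup_hom assms phi s by auto
  ultimately show "\<phi> s \<in> {commutator FreeGroup h k |h k. h \<in> H \<and> k \<in> K}" by blast
qed

lemma T_subgroup_lower_central: "T_subgroup H \<Longrightarrow> T_subgroup (lower_central FreeGroup H n)"
  by (induction n) (auto intro: T_subgroup_commutator_subgroup)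

lemma T_subgroup_join:
  assumes "T_subgroup H" "T_subgroup K"
  shows "T_subgroup (generate FreeGroup (H \<union> K))"
  using assms T_subgroup_hom
  by (intro T_subgroup_generate) (auto simp: T_subgroup_def dest: subgroup.subset)

lemma verbalI: "\<lbrakk>h \<in> H; \<pi> \<in> hom FreeGroup G\<rbrakk> \<Longrightarrow> \<pi> h \<in> verbal H G"
  by (auto simp: verbal_def)

context group
begin

text \<open>Sending the generators of even index by \<open>\<pi>1\<close> and those of odd index by \<open>\<pi>2\<close> realises two values
  of words by a single homomorphism.\<close>
lemma hom_FreeGroup_interleave:
  assumes "\<pi>1 \<in> hom FreeGroup G" "\<pi>2 \<in> hom FreeGroup G"
  obtains \<pi> \<alpha> \<beta> where "\<pi> \<in> hom FreeGroup G" "\<alpha> \<in> hom FreeGroup FreeGroup" "\<beta> \<in> hom FreeGroup FreeGroup"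
    "\<And>w. w \<in> carrier FreeGroup \<Longrightarrow> \<pi> (\<alpha> w) = \<pi>1 w" "\<And>w. w \<in> carrier FreeGroup \<Longrightarrow> \<pi> (\<beta> w) = \<pi>2 w"
proof -
  define f where "f i = (if even i then \<pi>1 (letter (i div 2)) else \<pi>2 (letter (i div 2)))" for i
  define \<pi> where "\<pi> = word_value G f"
  define \<alpha> where "\<alpha> = word_value FreeGroup (\<lambda>i. letter (2 * i))"
  define \<beta> where "\<beta> = word_value FreeGroup (\<lambda>i. letter (2 * i + 1))"
  have f: "range f \<subseteq> carrier G" using assms by (auto simp: f_def hom_in_carrier)
  have pi: "\<pi> \<in> hom FreeGroup G" unfolding \<pi>_def using f by (rule word_value_hom)
  have al: "\<alpha> \<in> hom FreeGroup FreeGroup" unfolding \<alpha>_def by (rule F.word_value_hom) auto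
  have be: "\<beta> \<in> hom FreeGroup FreeGroup" unfolding \<beta>_def by (rule F.word_value_hom) auto
  have "(\<pi> \<circ> \<alpha>) w = \<pi>1 w" if "w \<in> carrier FreeGroup" for w
  proof (rule hom_FreeGroup_eqI[OF Group.hom_compose[OF al pi] assms(1) _ that])
    fix i
    show "(\<pi> \<circ> \<alpha>) (letter i) = \<pi>1 (letter i)"
      using f by (simp add: \<pi>_def \<alpha>_def F.word_value_letter image_subset_iff) (simp add: f_def)
  qed
  moreover have "(\<pi> \<circ> \<beta>) w = \<pi>2 w" if "w \<in> carrier FreeGroup" for w
  proof (rule hom_FreeGroup_eqI[OF Group.hom_compose[OF be pi] assms(2) _ that])
    fix i
    show "(\<pi> \<circ> \<beta>) (letter i) = \<pi>2 (letter i)"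
      using f by (simp add: \<pi>_def \<beta>_def F.word_value_letter image_subset_iff) (simp add: f_def)
  qed
  ultimately show ?thesis using that[OF pi al be] by simp
qed

text \<open>The set \<open>verbal H G\<close> consists of single values, not of products of values.
  Closure under products comes from interleaving: two values under different homomorphisms are
  values of one homomorphism at \<open>\<alpha> h\<close> and \<open>\<beta> k\<close>, which remain
  in \<open>H\<close> because \<open>H\<close> is a T-subgroup. A conjugate is a value under the
  homomorphism followed by an inner automorphism.\<close>

lemma verbal_normal:
  assumes "T_subgroup H" shows "verbal H G \<lhd> G"
proof -
  have HF: "subgroup H FreeGroup" using assms by (simp add: T_subgroup_def)
  then have Hc: "h \<in> carrier FreeGroup" if "h \<in> H" for h using that by (meson subgroup.mem_carrier)
  have "subgroup (verbal H G) G"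
  proof (rule subgroupI)
    show "verbal H G \<subseteq> carrier G" by (auto simp: verbal_def hom_in_carrier Hc)
    have "(\<lambda>_. \<one>) \<in> hom FreeGroup G" by (auto intro: homI)
    then show "verbal H G \<noteq> {}" using subgroup.one_closed[OF HF] by (auto simp: verbal_def)
  next
    fix a assume "a \<in> verbal H G"
    then obtain h \<pi> where h: "h \<in> H" "\<pi> \<in> hom FreeGroup G" "a = \<pi> h" by (auto simp: verbal_def)
    interpret group_hom FreeGroup G \<pi> using h by unfold_locales
    have "inv a = \<pi> (inv\<^bsub>FreeGroup\<^esub> h)" using h Hc by simp
    then show "inv a \<in> verbal H G" using h subgroup.m_inv_closed[OF HF] by (metis verbalI)
  next
    fix a b assume "a \<in> verbal H G" "b \<in> verbal H G"
    then obtain h \<pi>1 k \<pi>2 where h: "h \<in> H" "\<pi>1 \<in> hom FreeGroup G" "a = \<pi>1 h"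
      and k: "k \<in> H" "\<pi>2 \<in> hom FreeGroup G" "b = \<pi>2 k" by (auto simp: verbal_def)
    obtain \<pi> \<alpha> \<beta> where *: "\<pi> \<in> hom FreeGroup G" "\<alpha> \<in> hom FreeGroup FreeGroup" "\<beta> \<in> hom FreeGroup FreeGroup"
      "\<And>w. w \<in> carrier FreeGroup \<Longrightarrow> \<pi> (\<alpha> w) = \<pi>1 w" "\<And>w. w \<in> carrier FreeGroup \<Longrightarrow> \<pi> (\<beta> w) = \<pi>2 w"
      by (rule hom_FreeGroup_interleave[OF h(2) k(2)]) blast
    interpret group_hom FreeGroup G \<pi> using * by unfold_locales
    have m: "\<alpha> h \<in> H" "\<beta> k \<in> H" using T_subgroup_hom[OF assms] * h k by auto
    then have "a \<otimes> b = \<pi> (\<alpha> h \<otimes>\<^bsub>FreeGroup\<^esub> \<beta> k)" using * h k Hc by simp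
    then show "a \<otimes> b \<in> verbal H G" using m subgroup.m_closed[OF HF] *(1) by (metis verbalI)
  qed
  then show ?thesis
  proof (rule normal_invI)
    fix g a assume g: "g \<in> carrier G" and "a \<in> verbal H G"
    then obtain h \<pi> where h: "h \<in> H" "\<pi> \<in> hom FreeGroup G" "a = \<pi> h" by (auto simp: verbal_def)
    have "(\<lambda>x. g \<otimes> \<pi> x \<otimes> inv g) \<in> hom FreeGroup G"
      using g h(2) by (auto intro!: homI simp: hom_in_carrier hom_mult m_assoc)
    then show "g \<otimes> a \<otimes> inv g \<in> verbal H G" using h by (auto simp: verbal_def)
  qed
qed

lemma carrier_subset_verbal: "carrier G \<subseteq> verbal (carrier FreeGroup) G"
proof
  fix g assume g: "g \<in> carrier G"
  have "word_value G (\<lambda>_. g) \<in> hom FreeGroup G" using g by (intro word_value_hom) auto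
  moreover have "g = word_value G (\<lambda>_. g) (letter 0)" using g by (subst word_value_letter) auto
  ultimately show "g \<in> verbal (carrier FreeGroup) G"
    unfolding verbal_def using letter_in_carrier by blast
qed

text \<open>Interleaving again, applied to generating commutators, since the right-hand side is
  already known to be a subgroup. Iterating this places the lower central terms and G'' inside
  verbal subgroups, so that they die in the corresponding quotients.\<close>

lemma commutator_subgroup_verbal_subset:
  assumes "T_subgroup H" "T_subgroup K"
  shows "commutator_subgroup G (verbal H G) (verbal K G) \<subseteq> verbal (commutator_subgroup FreeGroup H K) G"
proof (rule commutator_subgroup_least)
  show "subgroup (verbal (commutator_subgroup FreeGroup H K) G) G"
    using verbal_normal[OF T_subgroup_commutator_subgroup[OF assms]] by (rule normal_imp_subgroup)
  have Hc: "h \<in> carrier FreeGroup" if "h \<in> H \<union> K" for h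
    using that assms by (auto simp: T_subgroup_def dest: subgroup.mem_carrier)
  fix a b assume "a \<in> verbal H G" "b \<in> verbal K G"
  then obtain h \<pi>1 k \<pi>2 where h: "h \<in> H" "\<pi>1 \<in> hom FreeGroup G" "a = \<pi>1 h"
    and k: "k \<in> K" "\<pi>2 \<in> hom FreeGroup G" "b = \<pi>2 k" by (auto simp: verbal_def)
  obtain \<pi> \<alpha> \<beta> where *: "\<pi> \<in> hom FreeGroup G" "\<alpha> \<in> hom FreeGroup FreeGroup" "\<beta> \<in> hom FreeGroup FreeGroup"
    "\<And>w. w \<in> carrier FreeGroup \<Longrightarrow> \<pi> (\<alpha> w) = \<pi>1 w" "\<And>w. w \<in> carrier FreeGroup \<Longrightarrow> \<pi> (\<beta> w) = \<pi>2 w"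
    by (rule hom_FreeGroup_interleave[OF h(2) k(2)]) blast
  interpret group_hom FreeGroup G \<pi> using * by unfold_locales
  have m: "\<alpha> h \<in> H" "\<beta> k \<in> K" using T_subgroup_hom assms * h k by auto
  then have "commutator G a b = \<pi> (commutator FreeGroup (\<alpha> h) (\<beta> k))"
    using * h k Hc by (simp add: hom_commutator)
  then show "commutator G a b \<in> verbal (commutator_subgroup FreeGroup H K) G"
    using F.commutator_in_commutator_subgroup[OF m] *(1) by (metis verbalI)
qed

lemma lower_central_subset_verbal:
  "lower_central G (carrier G) n \<subseteq> verbal (lower_central FreeGroup (carrier FreeGroup) n) G"
proof (induction n)
  case 0
  show ?case using carrier_subset_verbal by simp
next
  case (Suc n)
  have "lower_central G (carrier G) (Suc n)
      \<subseteq> commutator_subgroup G (verbal (carrier FreeGroup) G)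
          (verbal (lower_central FreeGroup (carrier FreeGroup) n) G)"
    using Suc carrier_subset_verbal by (simp add: commutator_subgroup_mono)
  also have "\<dots> \<subseteq> verbal (lower_central FreeGroup (carrier FreeGroup) (Suc n)) G"
    using commutator_subgroup_verbal_subset T_subgroup_carrier T_subgroup_lower_central by simp
  finally show ?case .
qed

lemma derived_derived_subset_verbal:
  "derived G (derived G (carrier G))
    \<subseteq> verbal (derived FreeGroup (derived FreeGroup (carrier FreeGroup))) G"
proof -
  have T: "T_subgroup (derived FreeGroup (carrier FreeGroup))"
    by (simp add: derived_eq_commutator_subgroup T_subgroup_commutator_subgroup T_subgroup_carrier)
  have "derived G (carrier G) \<subseteq> verbal (derived FreeGroup (carrier FreeGroup)) G"
    using lower_central_subset_verbal[of "Suc 0"] unfolding lower_central_1 .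
  then have "derived G (derived G (carrier G))
      \<subseteq> commutator_subgroup G (verbal (derived FreeGroup (carrier FreeGroup)) G)
          (verbal (derived FreeGroup (carrier FreeGroup)) G)"
    unfolding derived_eq_commutator_subgroup[of G "derived G (carrier G)"]
    by (intro commutator_subgroup_mono)
  also have "\<dots> \<subseteq> verbal (derived FreeGroup (derived FreeGroup (carrier FreeGroup))) G"
    using commutator_subgroup_verbal_subset[OF T T]
    by (simp only: derived_eq_commutator_subgroup[of FreeGroup "derived FreeGroup (carrier FreeGroup)"])
  finally show ?thesis .
qed

end

lemma verbal_mono: "H \<subseteq> K \<Longrightarrow> verbal H G \<subseteq> verbal K G"
  by (auto simp: verbal_def)

section \<open>The maximal condition on normal subgroups\<close>

text \<open>The ascending chain condition for an arbitrary family of sets. It is phrased with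
  sequences because it is transferred between families along monotone maps; maximal elements follow
  by dependent choice.\<close>

definition max_condition :: "'a set set \<Rightarrow> bool" where
  "max_condition \<F> \<longleftrightarrow> (\<forall>f::nat \<Rightarrow> 'a set. (\<forall>n. f n \<in> \<F> \<and> f n \<subseteq> f (Suc n)) \<longrightarrow> (\<exists>n. \<forall>m\<ge>n. f m = f n))"

lemma max_conditionD:
  assumes "max_condition \<F>" "\<And>n. f n \<in> \<F>" "\<And>n. f n \<subseteq> f (Suc n)"
  obtains n :: nat where "\<And>m. m \<ge> n \<Longrightarrow> f m = f n"
proof -
  have "\<exists>n. \<forall>m\<ge>n. f m = f n" using assms(1) unfolding max_condition_def using assms(2,3) by simp
  then show ?thesis using that by blast
qed

lemma max_condition_subset: "\<lbrakk>max_condition \<F>; \<G> \<subseteq> \<F>\<rbrakk> \<Longrightarrow> max_condition \<G>"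
  unfolding max_condition_def by (simp add: subset_iff)

lemma max_condition_maximal:
  assumes "max_condition \<F>" "\<S> \<subseteq> \<F>" "\<S> \<noteq> {}"
  shows "\<exists>U\<in>\<S>. \<forall>Y\<in>\<S>. U \<subseteq> Y \<longrightarrow> Y = U"
proof (rule ccontr)
  assume "\<not> ?thesis"
  then have step: "\<exists>Y. Y \<in> \<S> \<and> U \<subset> Y" if "U \<in> \<S>" for U using that by blast
  obtain U0 where "U0 \<in> \<S>" using assms(3) by blast
  then obtain f where f: "\<And>n::nat. f n \<in> \<S>" "\<And>n. f n \<subset> f (Suc n)"
    using dependent_nat_choice[of "\<lambda>_ U. U \<in> \<S>" "\<lambda>_ U Y. U \<subset> Y"] step by metis
  then obtain n where "\<And>m. m \<ge> n \<Longrightarrow> f m = f n"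
    using max_conditionD[OF assms(1), of f] assms(2) by blast
  then show False using f(2)[of n] by (metis le_SucI order_refl psubsetE)
qed

lemma max_condition_pullback:
  assumes "max_condition \<F>"
    and "\<And>B. B \<in> \<G> \<Longrightarrow> \<phi> B \<in> \<F>"
    and "\<And>B B'. \<lbrakk>B \<in> \<G>; B' \<in> \<G>; B \<subseteq> B'\<rbrakk> \<Longrightarrow> \<phi> B \<subseteq> \<phi> B'"
    and "\<And>B B'. \<lbrakk>B \<in> \<G>; B' \<in> \<G>; B \<subseteq> B'; \<phi> B = \<phi> B'\<rbrakk> \<Longrightarrow> B = B'"
  shows "max_condition \<G>"
  unfolding max_condition_def
proof (intro allI impI)
  fix f :: "nat \<Rightarrow> 'b set" assume f: "\<forall>n. f n \<in> \<G> \<and> f n \<subseteq> f (Suc n)"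
  then obtain n where n: "\<And>m. m \<ge> n \<Longrightarrow> \<phi> (f m) = \<phi> (f n)"
    using max_conditionD[OF assms(1), of "\<lambda>n. \<phi> (f n)"] assms(2,3) by blast
  have "f n \<subseteq> f m" if "m \<ge> n" for m using that f by (simp add: lift_Suc_mono_le)
  then have "\<forall>m\<ge>n. f m = f n" using n assms(4) f by metis
  then show "\<exists>n. \<forall>m\<ge>n. f m = f n" by blast
qed

text \<open>Injectivity is asked on nested pairs only, which is what the modular law offers: nested
  subgroups with the same intersection with \<open>A\<close> and the same image modulo
  \<open>A\<close> coincide, while incomparable ones need not.\<close>

lemma max_condition_pullback2:
  assumes "max_condition \<F>1" "max_condition \<F>2"
    and "\<And>B. B \<in> \<G> \<Longrightarrow> \<phi>1 B \<in> \<F>1" "\<And>B. B \<in> \<G> \<Longrightarrow> \<phi>2 B \<in> \<F>2"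
    and "\<And>B B'. \<lbrakk>B \<in> \<G>; B' \<in> \<G>; B \<subseteq> B'\<rbrakk> \<Longrightarrow> \<phi>1 B \<subseteq> \<phi>1 B'"
    and "\<And>B B'. \<lbrakk>B \<in> \<G>; B' \<in> \<G>; B \<subseteq> B'\<rbrakk> \<Longrightarrow> \<phi>2 B \<subseteq> \<phi>2 B'"
    and "\<And>B B'. \<lbrakk>B \<in> \<G>; B' \<in> \<G>; B \<subseteq> B'; \<phi>1 B = \<phi>1 B'; \<phi>2 B = \<phi>2 B'\<rbrakk> \<Longrightarrow> B = B'"
  shows "max_condition \<G>"
  unfolding max_condition_def
proof (intro allI impI)
  fix f :: "nat \<Rightarrow> 'c set" assume f: "\<forall>n. f n \<in> \<G> \<and> f n \<subseteq> f (Suc n)"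
  obtain n1 where n1: "\<And>m. m \<ge> n1 \<Longrightarrow> \<phi>1 (f m) = \<phi>1 (f n1)"
    using max_conditionD[OF assms(1), of "\<lambda>n. \<phi>1 (f n)"] assms(3,5) f by blast
  obtain n2 where n2: "\<And>m. m \<ge> n2 \<Longrightarrow> \<phi>2 (f m) = \<phi>2 (f n2)"
    using max_conditionD[OF assms(2), of "\<lambda>n. \<phi>2 (f n)"] assms(4,6) f by blast
  define n where "n = max n1 n2"
  have "f m = f n" if "m \<ge> n" for m
  proof -
    have "f n \<subseteq> f m" using that f by (simp add: lift_Suc_mono_le)
    moreover have "\<phi>1 (f n) = \<phi>1 (f m)" "\<phi>2 (f n) = \<phi>2 (f m)"
      using n1[of n] n1[of m] n2[of n] n2[of m] that by (auto simp: n_def)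
    ultimately show ?thesis using assms(7)[of "f n" "f m"] f by simp
  qed
  then show "\<exists>n. \<forall>m\<ge>n. f m = f n" by blast
qed

text \<open>The double array \<open>L n (f m)\<close> increases in both indices. Its diagonal is
  constant from some \<open>d\<close> on, which by monotonicity fixes all entries with both indices
  at least \<open>d\<close>; the finitely many rows below \<open>d\<close> stabilise one by one.
  Beyond the largest of these bounds all rows are constant.\<close>

lemma max_condition_pullback_sequence:
  fixes L :: "nat \<Rightarrow> 'b set \<Rightarrow> 'a set"
  assumes "max_condition \<F>"
    and L: "\<And>n B. B \<in> \<G> \<Longrightarrow> L n B \<in> \<F>"
    and L_Suc: "\<And>n B. B \<in> \<G> \<Longrightarrow> L n B \<subseteq> L (Suc n) B"
    and L_mono: "\<And>n B B'. \<lbrakk>B \<in> \<G>; B' \<in> \<G>; B \<subseteq> B'\<rbrakk> \<Longrightarrow> L n B \<subseteq> L n B'"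
    and inj: "\<And>B B'. \<lbrakk>B \<in> \<G>; B' \<in> \<G>; B \<subseteq> B'; \<And>n. L n B = L n B'\<rbrakk> \<Longrightarrow> B = B'"
  shows "max_condition \<G>"
  unfolding max_condition_def
proof (intro allI impI)
  fix f :: "nat \<Rightarrow> 'b set" assume f: "\<forall>n. f n \<in> \<G> \<and> f n \<subseteq> f (Suc n)"
  have f_mono: "f n \<subseteq> f m" if "n \<le> m" for n m using that f by (simp add: lift_Suc_mono_le)
  have L_le: "L n (f m) \<subseteq> L n' (f m')" if "n \<le> n'" "m \<le> m'" for n n' m m'
  proof -
    have "L n (f m) \<subseteq> L n' (f m)"
      using lift_Suc_mono_le[of "\<lambda>n. L n (f m)", OF _ that(1)] L_Suc f by simp
    also have "\<dots> \<subseteq> L n' (f m')" using L_mono f f_mono[OF that(2)] by simp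
    finally show ?thesis .
  qed
  obtain d where d: "\<And>m. m \<ge> d \<Longrightarrow> L m (f m) = L d (f d)"
    by (rule max_conditionD[OF assms(1), of "\<lambda>m. L m (f m)"]) (use L f L_le in auto)
  have diag: "L n (f m) = L d (f d)" if "n \<ge> d" "m \<ge> d" for n m
  proof
    show "L d (f d) \<subseteq> L n (f m)" using that by (rule L_le)
    have "L n (f m) \<subseteq> L (max n m) (f (max n m))" by (rule L_le) auto
    also have "\<dots> = L d (f d)" using that by (intro d) auto
    finally show "L n (f m) \<subseteq> L d (f d)" .
  qed
  have "\<forall>n. \<exists>k. \<forall>m\<ge>k. L n (f m) = L n (f k)"
  proof
    fix n
    show "\<exists>k. \<forall>m\<ge>k. L n (f m) = L n (f k)"
      by (rule max_conditionD[OF assms(1), of "\<lambda>m. L n (f m)"]) (use L f L_le in auto)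
  qed
  then obtain k where k: "\<And>n m. m \<ge> k n \<Longrightarrow> L n (f m) = L n (f (k n))" by metis
  define M where "M = Max (insert d (k ` {..<d}))"
  have "d \<le> M" unfolding M_def by (rule Max_ge) auto
  have kM: "k n \<le> M" if "n < d" for n unfolding M_def using that by (intro Max_ge) auto
  have "f m = f M" if "m \<ge> M" for m
  proof -
    have "L n (f M) = L n (f m)" for n
    proof (cases "n < d")
      case True
      then show ?thesis using k[of n M] k[of n m] kM[OF True] that by simp
    next
      case False
      then show ?thesis using diag[of n M] diag[of n m] \<open>d \<le> M\<close> that by simp
    qed
    then show ?thesis using inj[of "f M" "f m"] f f_mono[OF that] by simp
  qed
  then show "\<exists>n. \<forall>m\<ge>n. f m = f n" by blast
qed

text \<open>Take the least positive integer \<open>d\<close> that occurs anywhere in the chain, say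
  in \<open>f n\<close>. The remainder modulo \<open>d\<close> of an element of a later member lies
  in that member and is below \<open>d\<close>, hence is 0, so the chain stops at
  \<open>f n\<close>. Without positive elements every member is {0}.\<close>

lemma max_condition_int_subgroups: "max_condition {N :: int set. 0 \<in> N \<and> (\<forall>x\<in>N. \<forall>y\<in>N. x - y \<in> N)}" (is "max_condition ?\<Z>")
  unfolding max_condition_def
proof (intro allI impI)
  fix f :: "nat \<Rightarrow> int set" assume f: "\<forall>n. f n \<in> ?\<Z> \<and> f n \<subseteq> f (Suc n)"
  have f_mono: "f n \<subseteq> f m" if "n \<le> m" for n m using that f by (simp add: lift_Suc_mono_le)
  have zero: "0 \<in> f n" and diff: "\<lbrakk>x \<in> f n; y \<in> f n\<rbrakk> \<Longrightarrow> x - y \<in> f n" for n x y using f by auto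
  have uminus: "x \<in> f n \<Longrightarrow> - x \<in> f n" for n x using diff[OF zero, of x n] by simp
  have nat_mult: "x \<in> f n \<Longrightarrow> int k * x \<in> f n" for n x k
  proof (induction k)
    case (Suc k)
    then show ?case using diff[of "int k * x" n "- x"] uminus[of x n] by (simp add: algebra_simps)
  qed (simp add: zero)
  have mult: "x \<in> f n \<Longrightarrow> k * x \<in> f n" for n x k
    using nat_mult[of x n "nat k"] uminus[OF nat_mult[of x n "nat (- k)"]] by (cases "k \<ge> 0") auto
  show "\<exists>n. \<forall>m\<ge>n. f m = f n"
  proof (cases "\<exists>d n. int d \<in> f n \<and> d > 0")
    case False
    have "f m = {0}" for m
    proof -
      have "x = 0" if "x \<in> f m" for x
      proof (rule ccontr)
        assume "x \<noteq> 0"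
        then have "int (nat \<bar>x\<bar>) \<in> f m \<and> nat \<bar>x\<bar> > 0"
          using that uminus[OF that] by (auto simp: abs_if)
        then show False using False by blast
      qed
      then show ?thesis using zero by auto
    qed
    then show ?thesis by auto
  next
    case True
    define d where "d = (LEAST d. d > 0 \<and> (\<exists>n. int d \<in> f n))"
    have "d > 0 \<and> (\<exists>n. int d \<in> f n)" unfolding d_def using True
      LeastI[of "\<lambda>d. d > 0 \<and> (\<exists>n. int d \<in> f n)"] by blast
    then obtain n where d: "d > 0" "int d \<in> f n" by auto
    have "f m \<subseteq> f n" if "m \<ge> n" for m
    proof
      fix x assume x: "x \<in> f m"
      have "x - (x div int d) * int d \<in> f m"
        using x d(2) f_mono[OF that] by (intro diff mult) auto
      then have "int (nat (x mod int d)) \<in> f m" using d(1) by (simp add: minus_div_mult_eq_mod)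
      moreover have "nat (x mod int d) < d" using d(1) by (simp add: nat_less_iff)
      ultimately have "nat (x mod int d) = 0"
        using not_less_Least[of "nat (x mod int d)" "\<lambda>d. d > 0 \<and> (\<exists>n. int d \<in> f n)"]
        unfolding d_def[symmetric] by auto
      then have "x mod int d = 0" using d(1) pos_mod_sign[of "int d" x] by linarith
      then have "x = (x div int d) * int d" using div_mult_mod_eq[of x "int d"] by linarith
      then show "x \<in> f n" using mult[OF d(2), of "x div int d"] by metis
    qed
    then show ?thesis using f_mono by blast
  qed
qed

section \<open>Noetherian modules over commuting endomorphisms\<close>

definition invariant_subgroups :: "('a, 'b) monoid_scheme \<Rightarrow> ('a \<Rightarrow> 'a) set \<Rightarrow> 'a set \<Rightarrow> 'a set set" where
  "invariant_subgroups G T U = {B. subgroup B G \<and> B \<subseteq> U \<and> (\<forall>\<tau>\<in>T. \<tau> ` B \<subseteq> B)}"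

text \<open>In additive notation, the sums \<open>x\<^sub>0 + \<tau> x\<^sub>1 + \<dots> + \<tau>\<^sup>n\<^sup>-\<^sup>1 x\<^sub>n\<^sub>-\<^sub>1\<close> with all \<open>x\<^sub>i\<close> in \<open>U\<close>.\<close>
primrec polynomials :: "('a, 'b) monoid_scheme \<Rightarrow> ('a \<Rightarrow> 'a) \<Rightarrow> 'a set \<Rightarrow> nat \<Rightarrow> 'a set" where
  "polynomials G \<tau> U 0 = {\<one>\<^bsub>G\<^esub>}"
| "polynomials G \<tau> U (Suc n) = ((\<tau> ^^ n) ` U) <#>\<^bsub>G\<^esub> polynomials G \<tau> U n"

context comm_group
begin

lemma hom_funpow: "\<tau> \<in> hom G G \<Longrightarrow> \<tau> ^^ n \<in> hom G G"
  by (induction n) (auto intro!: homI simp: hom_in_carrier hom_mult)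

lemma hom_image_subgroup: "\<lbrakk>\<tau> \<in> hom G G; subgroup U G\<rbrakk> \<Longrightarrow> subgroup (\<tau> ` U) G"
  using group_hom.subgroup_img_is_subgroup[of G G \<tau> U]
  by (simp add: group_hom_def group_hom_axioms_def)

lemma polynomials_subgroup:
  "\<lbrakk>\<tau> \<in> hom G G; subgroup U G\<rbrakk> \<Longrightarrow> subgroup (polynomials G \<tau> U n) G"
  by (induction n) (auto intro!: mult_subgroups hom_image_subgroup hom_funpow triv_subgroup)

lemma polynomials_commuting_image:
  assumes "\<tau> \<in> hom G G" "subgroup U G" "\<sigma> \<in> hom G G" "\<sigma> ` U \<subseteq> U"
    and comm: "\<And>x. x \<in> carrier G \<Longrightarrow> \<sigma> (\<tau> x) = \<tau> (\<sigma> x)"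
  shows "\<sigma> ` polynomials G \<tau> U n \<subseteq> polynomials G \<tau> U n"
    and "x \<in> carrier G \<Longrightarrow> \<sigma> ((\<tau> ^^ n) x) = (\<tau> ^^ n) (\<sigma> x)"
proof -
  have pow_closed: "x \<in> carrier G \<Longrightarrow> (\<tau> ^^ n) x \<in> carrier G" for x n
    using hom_funpow[OF assms(1)] by (rule hom_in_carrier)
  show pow: "x \<in> carrier G \<Longrightarrow> \<sigma> ((\<tau> ^^ n) x) = (\<tau> ^^ n) (\<sigma> x)" for x n
    by (induction n) (auto simp: comm pow_closed)
  have U: "U \<subseteq> carrier G" using assms(2) by (rule subgroup.subset)
  show "\<sigma> ` polynomials G \<tau> U n \<subseteq> polynomials G \<tau> U n"
  proof (induction n)
    case 0
    show ?case using hom_one[OF assms(3) is_group is_group] by simp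
  next
    case (Suc n)
    show ?case
    proof
      fix z assume "z \<in> \<sigma> ` polynomials G \<tau> U (Suc n)"
      then obtain x y where xy: "x \<in> U" "y \<in> polynomials G \<tau> U n" "z = \<sigma> ((\<tau> ^^ n) x \<otimes> y)"
        by (auto simp: set_mult_def)
      have "x \<in> carrier G" "y \<in> carrier G"
        using xy U subgroup.subset[OF polynomials_subgroup[OF assms(1,2)]] by auto
      then have "z = (\<tau> ^^ n) (\<sigma> x) \<otimes> \<sigma> y"
        using xy(3) hom_mult[OF assms(3)] pow_closed pow by simp
      then show "z \<in> polynomials G \<tau> U (Suc n)"
        using imageI[OF xy(1), of \<sigma>] imageI[OF xy(2), of \<sigma>] assms(4) Suc
        unfolding polynomials.simps set_mult_def by blast
    qed
  qed
qed

text \<open>Applying \<open>\<tau>\<close> is multiplication by the variable: it raises the degree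
  bound by one, so only the union over all degrees is invariant.\<close>

lemma polynomials_shift:
  assumes "\<tau> \<in> hom G G" "subgroup U G"
  shows "\<tau> ` polynomials G \<tau> U n \<subseteq> polynomials G \<tau> U (Suc n)"
proof (induction n)
  case 0
  show ?case using hom_one[OF assms(1) is_group is_group] subgroup.one_closed[OF assms(2)]
    by (force simp: set_mult_def)
next
  case (Suc n)
  show ?case
  proof
    fix z assume "z \<in> \<tau> ` polynomials G \<tau> U (Suc n)"
    then obtain x y where xy: "x \<in> U" "y \<in> polynomials G \<tau> U n" "z = \<tau> ((\<tau> ^^ n) x \<otimes> y)"
      by (auto simp: set_mult_def)
    have "x \<in> carrier G" "y \<in> carrier G"
      using xy subgroup.subset[OF assms(2)] subgroup.subset[OF polynomials_subgroup[OF assms]] by auto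
    then have "z = (\<tau> ^^ Suc n) x \<otimes> \<tau> y"
      using xy(3) hom_mult[OF assms(1)] hom_in_carrier[OF hom_funpow[OF assms(1)]] by simp
    moreover have "\<tau> y \<in> polynomials G \<tau> U (Suc n)" using xy(2) Suc by blast
    ultimately show "z \<in> polynomials G \<tau> U (Suc (Suc n))"
      using xy(1) unfolding polynomials.simps(2)[of G \<tau> U "Suc n"] set_mult_def by blast
  qed
qed

lemma polynomials_Suc_subset:
  assumes "\<tau> \<in> hom G G" "subgroup U G"
  shows "polynomials G \<tau> U n \<subseteq> polynomials G \<tau> U (Suc n)"
proof
  fix y assume y: "y \<in> polynomials G \<tau> U n"
  then have "y \<in> carrier G" using subgroup.subset[OF polynomials_subgroup[OF assms]] by auto
  then have "y = (\<tau> ^^ n) \<one> \<otimes> y" using hom_one[OF hom_funpow[OF assms(1)] is_group is_group] by simp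
  then show "y \<in> polynomials G \<tau> U (Suc n)"
    using y subgroup.one_closed[OF assms(2)] unfolding polynomials.simps set_mult_def by blast
qed

text \<open>Hilbert's basis theorem: an invariant subgroup \<open>B\<close> of the module of polynomials is determined by
  the groups of leading coefficients of its elements of each degree.\<close>
lemma max_condition_invariant_subgroups_polynomials:
  assumes T: "T \<subseteq> hom G G" and \<tau>: "\<tau> \<in> hom G G"
    and comm: "\<And>\<sigma> x. \<lbrakk>\<sigma> \<in> T; x \<in> carrier G\<rbrakk> \<Longrightarrow> \<sigma> (\<tau> x) = \<tau> (\<sigma> x)"
    and U: "subgroup U G" "\<And>\<sigma>. \<sigma> \<in> T \<Longrightarrow> \<sigma> ` U \<subseteq> U"
    and mc: "max_condition (invariant_subgroups G T U)"
  shows "max_condition (invariant_subgroups G (insert \<tau> T) (\<Union>n. polynomials G \<tau> U n))"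
proof -
  let ?P = "polynomials G \<tau> U"
  let ?\<G> = "invariant_subgroups G (insert \<tau> T) (\<Union>n. ?P n)"
  \<comment> \<open>The coefficients of an element need not be unique, as \<open>\<tau>\<close> may
    have relations on \<open>U\<close>. The existential quantifier admits every expression of the
    element, and this is what makes \<open>L n B\<close> a subgroup that depends monotonically on
    \<open>B\<close>.\<close>
  define L where "L n B = {a \<in> U. \<exists>y\<in>?P n. (\<tau> ^^ n) a \<otimes> y \<in> B}" for n B
  note pow_hom = hom_funpow[OF \<tau>]
  have Uc: "a \<in> carrier G" if "a \<in> U" for a using that U(1) by (meson subgroup.mem_carrier)
  have powc: "(\<tau> ^^ n) a \<in> carrier G" if "a \<in> U" for a n using hom_in_carrier[OF pow_hom Uc[OF that]] .
  have P: "subgroup (?P n) G" for n using \<tau> U(1) by (rule polynomials_subgroup)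
  then have Pc: "y \<in> carrier G" if "y \<in> ?P n" for y n using that by (meson subgroup.mem_carrier)
  show ?thesis
  proof (rule max_condition_pullback_sequence[OF mc, of _ L])
    fix n B assume "B \<in> ?\<G>"
    then have B: "subgroup B G" "\<tau> ` B \<subseteq> B" "\<And>\<sigma>. \<sigma> \<in> T \<Longrightarrow> \<sigma> ` B \<subseteq> B"
      by (auto simp: invariant_subgroups_def)
    have "subgroup (L n B) G"
    proof (rule subgroupI)
      show "L n B \<subseteq> carrier G" using Uc by (auto simp: L_def)
      have "(\<tau> ^^ n) \<one> \<otimes> \<one> \<in> B"
        using hom_one[OF pow_hom is_group is_group] subgroup.one_closed[OF B(1)] by simp
      then have "\<one> \<in> L n B" using subgroup.one_closed[OF U(1)] subgroup.one_closed[OF P]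
        by (auto simp: L_def)
      then show "L n B \<noteq> {}" by blast
    next
      fix a assume "a \<in> L n B"
      then obtain y where a: "a \<in> U" "y \<in> ?P n" "(\<tau> ^^ n) a \<otimes> y \<in> B" by (auto simp: L_def)
      interpret h: group_hom G G "\<tau> ^^ n" using pow_hom by unfold_locales
      have "inv ((\<tau> ^^ n) a \<otimes> y) = (\<tau> ^^ n) (inv a) \<otimes> inv y"
        using a(1,2) Uc Pc powc by (simp add: inv_mult)
      then have "(\<tau> ^^ n) (inv a) \<otimes> inv y \<in> B" using subgroup.m_inv_closed[OF B(1) a(3)] by simp
      then show "inv a \<in> L n B"
        using a subgroup.m_inv_closed[OF U(1)] subgroup.m_inv_closed[OF P] by (auto simp: L_def)
    next
      fix a b assume "a \<in> L n B" "b \<in> L n B"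
      then obtain y z where a: "a \<in> U" "y \<in> ?P n" "(\<tau> ^^ n) a \<otimes> y \<in> B"
        and b: "b \<in> U" "z \<in> ?P n" "(\<tau> ^^ n) b \<otimes> z \<in> B" by (auto simp: L_def)
      have "((\<tau> ^^ n) a \<otimes> y) \<otimes> ((\<tau> ^^ n) b \<otimes> z) = (\<tau> ^^ n) (a \<otimes> b) \<otimes> (y \<otimes> z)"
        using a(1,2) b(1,2) Uc Pc powc hom_mult[OF pow_hom] by (simp add: m_ac)
      then have "(\<tau> ^^ n) (a \<otimes> b) \<otimes> (y \<otimes> z) \<in> B" using subgroup.m_closed[OF B(1) a(3) b(3)] by simp
      then show "a \<otimes> b \<in> L n B"
        using a b subgroup.m_closed[OF U(1)] subgroup.m_closed[OF P] by (auto simp: L_def)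
    qed
    moreover have "\<sigma> a \<in> L n B" if "\<sigma> \<in> T" and aL: "a \<in> L n B" for \<sigma> a
    proof -
      obtain y where a: "a \<in> U" "y \<in> ?P n" "(\<tau> ^^ n) a \<otimes> y \<in> B" using aL by (auto simp: L_def)
      have \<sigma>: "\<sigma> \<in> hom G G" using T \<open>\<sigma> \<in> T\<close> by blast
      note img = polynomials_commuting_image[OF \<tau> U(1) \<sigma> U(2)[OF \<open>\<sigma> \<in> T\<close>] comm[OF \<open>\<sigma> \<in> T\<close>]]
      have "\<sigma> ((\<tau> ^^ n) a \<otimes> y) = (\<tau> ^^ n) (\<sigma> a) \<otimes> \<sigma> y"
        using a(1,2) Uc Pc powc hom_mult[OF \<sigma>] img(2) by simp
      moreover have "\<sigma> ((\<tau> ^^ n) a \<otimes> y) \<in> B" using B(3)[OF \<open>\<sigma> \<in> T\<close>] a(3) by blast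
      moreover have "\<sigma> y \<in> ?P n" using img(1) a(2) by blast
      ultimately show ?thesis using U(2)[OF \<open>\<sigma> \<in> T\<close>] a(1) unfolding L_def by auto
    qed
    moreover have "L n B \<subseteq> U" by (auto simp: L_def)
    ultimately show "L n B \<in> invariant_subgroups G T U" by (auto simp: invariant_subgroups_def)
    show "L n B \<subseteq> L (Suc n) B"
    proof
      fix a assume "a \<in> L n B"
      then obtain y where a: "a \<in> U" "y \<in> ?P n" "(\<tau> ^^ n) a \<otimes> y \<in> B" by (auto simp: L_def)
      have "\<tau> ((\<tau> ^^ n) a \<otimes> y) = (\<tau> ^^ Suc n) a \<otimes> \<tau> y"
        using a(1,2) Pc powc hom_mult[OF \<tau>] by simp
      moreover have "\<tau> ((\<tau> ^^ n) a \<otimes> y) \<in> B" using B(2) a(3) by blast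
      moreover have "\<tau> y \<in> ?P (Suc n)" using polynomials_shift[OF \<tau> U(1)] a(2) by blast
      ultimately show "a \<in> L (Suc n) B" using a(1) unfolding L_def by auto
    qed
  next
    fix n and B B' :: "'a set" assume "B \<subseteq> B'"
    then show "L n B \<subseteq> L n B'" by (auto simp: L_def)
  next
    fix B B' assume "B \<in> ?\<G>" "B' \<in> ?\<G>" and sub: "B \<subseteq> B'" and eq: "\<And>n. L n B = L n B'"
    then have B: "subgroup B G" and B': "subgroup B' G" "B' \<subseteq> (\<Union>n. ?P n)"
      by (auto simp: invariant_subgroups_def)
    \<comment> \<open>Induction on the degree: an element of \<open>B\<close> with the same leading
      coefficient is divided out, and the quotient lies in \<open>B'\<close> and has lower
      degree.\<close>
    have "B' \<inter> ?P n \<subseteq> B" for n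
    proof (induction n)
      case 0
      show ?case using subgroup.one_closed[OF B] by auto
    next
      case (Suc n)
      show ?case
      proof
        fix b' assume b': "b' \<in> B' \<inter> ?P (Suc n)"
        then obtain a y where a: "a \<in> U" "y \<in> ?P n" "b' = (\<tau> ^^ n) a \<otimes> y" by (auto simp: set_mult_def)
        then have "a \<in> L n B" using b' eq by (auto simp: L_def)
        then obtain z where z: "z \<in> ?P n" "(\<tau> ^^ n) a \<otimes> z \<in> B" by (auto simp: L_def)
        have yz: "b' \<otimes> inv ((\<tau> ^^ n) a \<otimes> z) = y \<otimes> inv z"
          using a z(1) Pc powc[of a n] by (simp add: inv_mult m_ac)
        have "y \<otimes> inv z \<in> ?P n" using P a(2) z(1) by (meson subgroup.m_closed subgroup.m_inv_closed)
        moreover have "y \<otimes> inv z \<in> B'"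
          using yz b' z(2) sub B'(1) by (metis IntD1 subgroup.m_closed subgroup.m_inv_closed subsetD)
        ultimately have "y \<otimes> inv z \<in> B" using Suc by blast
        then have "(y \<otimes> inv z) \<otimes> ((\<tau> ^^ n) a \<otimes> z) \<in> B" using z(2) B by (meson subgroup.m_closed)
        moreover have "(y \<otimes> inv z) \<otimes> ((\<tau> ^^ n) a \<otimes> z) = b'"
          using a z(1) Pc powc[of a n] by (simp add: m_ac)
        ultimately show "b' \<in> B" by simp
      qed
    qed
    then show "B = B'" using B'(2) sub by blast
  qed
qed

text \<open>The invariant subgroups are the submodules over the polynomial ring Z[T], which is never
  formed. Each induction step passes from a ring R to R[\<tau>] by replacing \<open>Y\<close> with
  all polynomials in \<open>\<tau>\<close> over \<open>Y\<close>; by commutativity the earlier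
  operators act on coefficients, so the new group is still invariant under them.\<close>

lemma max_condition_invariant_subgroups_adjoin:
  assumes "finite T" "T \<subseteq> hom G G"
    and comm: "\<And>\<sigma> \<tau> x. \<lbrakk>\<sigma> \<in> T; \<tau> \<in> T; x \<in> carrier G\<rbrakk> \<Longrightarrow> \<sigma> (\<tau> x) = \<tau> (\<sigma> x)"
    and "subgroup U G" "max_condition (invariant_subgroups G {} U)"
  shows "\<exists>Y. subgroup Y G \<and> U \<subseteq> Y \<and> (\<forall>\<tau>\<in>T. \<tau> ` Y \<subseteq> Y) \<and> max_condition (invariant_subgroups G T Y)"
  using assms(1-3)
proof (induction T rule: finite_induct)
  case empty
  then show ?case using assms(4,5) by auto
next
  case (insert \<tau> T)
  have \<tau>: "\<tau> \<in> hom G G" and T: "T \<subseteq> hom G G" using insert.prems by auto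
  obtain Y where Y: "subgroup Y G" "U \<subseteq> Y" "\<And>\<sigma>. \<sigma> \<in> T \<Longrightarrow> \<sigma> ` Y \<subseteq> Y" "max_condition (invariant_subgroups G T Y)"
    using insert.IH[OF T] insert.prems(2) by auto
  have comm: "\<sigma> (\<tau> x) = \<tau> (\<sigma> x)" if "\<sigma> \<in> T" "x \<in> carrier G" for \<sigma> x
    using insert.prems(2) that by simp
  let ?P = "polynomials G \<tau> Y" and ?Z = "\<Union>n. polynomials G \<tau> Y n"
  have P: "subgroup (?P n) G" for n using \<tau> Y(1) by (rule polynomials_subgroup)
  have P_mono: "?P n \<subseteq> ?P m" if "n \<le> m" for n m
    using lift_Suc_mono_le[of ?P, OF _ that] polynomials_Suc_subset[OF \<tau> Y(1)] by simp
  have "subgroup ?Z G"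
  proof (rule subgroupI)
    show "?Z \<subseteq> carrier G" using subgroup.subset[OF P] by blast
    show "?Z \<noteq> {}" using subgroup.one_closed[OF P] by blast
    show "inv a \<in> ?Z" if "a \<in> ?Z" for a using that subgroup.m_inv_closed[OF P] by blast
    fix a b assume "a \<in> ?Z" "b \<in> ?Z"
    then obtain n m where "a \<in> ?P n" "b \<in> ?P m" by blast
    then have "a \<in> ?P (max n m)" "b \<in> ?P (max n m)" using P_mono by (meson max.cobounded1 max.cobounded2 subsetD)+
    then show "a \<otimes> b \<in> ?Z" using subgroup.m_closed[OF P] by blast
  qed
  moreover have "U \<subseteq> ?Z"
  proof -
    have "y \<in> ?P 1" if "y \<in> Y" for y
      using that subgroup.mem_carrier[OF Y(1) that] by (force simp: set_mult_def)
    then show ?thesis using Y(2) by blast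
  qed
  moreover have "\<tau> ` ?Z \<subseteq> ?Z" using polynomials_shift[OF \<tau> Y(1)] by blast
  moreover have "\<sigma> ` ?Z \<subseteq> ?Z" if "\<sigma> \<in> T" for \<sigma>
    using polynomials_commuting_image(1)[OF \<tau> Y(1) _ Y(3)[OF that] comm[OF that]] T that by blast
  moreover have "max_condition (invariant_subgroups G (insert \<tau> T) ?Z)"
    using T \<tau> comm Y(1,3,4) by (rule max_condition_invariant_subgroups_polynomials)
  ultimately show ?case by (metis insert_iff)
qed

text \<open>Finitely generated abelian groups are Noetherian, by induction on the generators. A
  subgroup is determined, among nested ones, by its part in \<open>generate G S\<close> and by the
  group of exponents of the new generator \<open>a\<close> that occur in it.\<close>

lemma max_condition_subgroups_generate:
  assumes "finite S" "S \<subseteq> carrier G"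
  shows "max_condition {B. subgroup B G \<and> B \<subseteq> generate G S}"
  using assms
proof (induction S rule: finite_induct)
  case empty
  have "B = {\<one>}" if "subgroup B G \<and> B \<subseteq> generate G {}" for B
    using that subgroup.one_closed generate_subgroup_incl[OF _ triv_subgroup, of "{}"] by auto
  then show ?case unfolding max_condition_def by (metis mem_Collect_eq)
next
  case (insert a S)
  then have a: "a \<in> carrier G" and S: "S \<subseteq> carrier G" by auto
  define L where "L B = {n::int. \<exists>x\<in>generate G S. a [^] n \<otimes> x \<in> B}" for B
  have gS: "subgroup (generate G S) G" using S by (rule generate_is_subgroup)
  then have gc: "x \<in> carrier G" if "x \<in> generate G S" for x using that by (meson subgroup.mem_carrier)
  have gen: "\<exists>n::int. \<exists>x\<in>generate G S. b = a [^] n \<otimes> x" if "b \<in> generate G (insert a S)" for b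
    using that
  proof (induction rule: generate.induct)
    case one
    show ?case using subgroup.one_closed[OF gS] by (intro exI[of _ 0] bexI[of _ \<one>]) auto
  next
    case (incl h)
    show ?case
    proof (cases "h = a")
      case True
      then show ?thesis using subgroup.one_closed[OF gS] a by (intro exI[of _ 1] bexI[of _ \<one>]) auto
    next
      case False
      then show ?thesis using incl S by (intro exI[of _ 0] bexI[of _ h]) (auto intro: generate.incl)
    qed
  next
    case (inv h)
    show ?case
    proof (cases "h = a")
      case True
      then show ?thesis using subgroup.one_closed[OF gS] a
        by (intro exI[of _ "-1"] bexI[of _ \<one>]) (auto simp: int_pow_neg)
    next
      case False
      then show ?thesis using inv S
        by (intro exI[of _ 0] bexI[of _ "inv h"]) (auto intro: generate.inv)
    qed
  next
    case (eng h1 h2)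
    then obtain n x m y where h: "h1 = a [^] (n::int) \<otimes> x" "h2 = a [^] (m::int) \<otimes> y"
      "x \<in> generate G S" "y \<in> generate G S" by blast
    have "h1 \<otimes> h2 = a [^] (n + m) \<otimes> (x \<otimes> y)"
      using h gc a by (simp add: int_pow_mult m_ac)
    then show ?case using h subgroup.m_closed[OF gS] by blast
  qed
  show ?case
  proof (rule max_condition_pullback2[OF insert.IH[OF S] max_condition_int_subgroups, of _ "\<lambda>B. B \<inter> generate G S" L])
    fix B assume "B \<in> {B. subgroup B G \<and> B \<subseteq> generate G (insert a S)}"
    then have B: "subgroup B G" by simp
    show "B \<inter> generate G S \<in> {B. subgroup B G \<and> B \<subseteq> generate G S}"
      using subgroups_Inter_pair[OF B gS] by simp
    have "0 \<in> L B"
      using subgroup.one_closed[OF B] subgroup.one_closed[OF gS] by (auto simp: L_def intro!: bexI[of _ \<one>])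
    moreover have "n - m \<in> L B" if n: "n \<in> L B" and m: "m \<in> L B" for n m
    proof -
      obtain x y where xy: "x \<in> generate G S" "a [^] n \<otimes> x \<in> B" "y \<in> generate G S" "a [^] m \<otimes> y \<in> B"
        using n m by (auto simp: L_def)
      have "(a [^] n \<otimes> x) \<otimes> inv (a [^] m \<otimes> y) = a [^] (n - m) \<otimes> (x \<otimes> inv y)"
        using xy gc a by (simp add: int_pow_diff inv_mult m_ac)
      moreover have "(a [^] n \<otimes> x) \<otimes> inv (a [^] m \<otimes> y) \<in> B"
        using xy B by (meson subgroup.m_closed subgroup.m_inv_closed)
      moreover have "x \<otimes> inv y \<in> generate G S"
        using xy gS by (meson subgroup.m_closed subgroup.m_inv_closed)
      ultimately show ?thesis by (auto simp: L_def)
    qed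
    ultimately show "L B \<in> {N. 0 \<in> N \<and> (\<forall>x\<in>N. \<forall>y\<in>N. x - y \<in> N)}" by blast
  next
    fix B B' assume "B \<in> {B. subgroup B G \<and> B \<subseteq> generate G (insert a S)}"
      "B' \<in> {B. subgroup B G \<and> B \<subseteq> generate G (insert a S)}" and sub: "B \<subseteq> B'"
      and eq: "B \<inter> generate G S = B' \<inter> generate G S" "L B = L B'"
    then have B: "subgroup B G" and B': "subgroup B' G" "B' \<subseteq> generate G (insert a S)" by auto
    have "b' \<in> B" if b': "b' \<in> B'" for b'
    proof -
      obtain n x where n: "b' = a [^] (n::int) \<otimes> x" "x \<in> generate G S" using gen B'(2) b' by blast
      then have "n \<in> L B" using b' eq(2) by (auto simp: L_def)
      then obtain z where z: "z \<in> generate G S" "a [^] n \<otimes> z \<in> B" by (auto simp: L_def)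
      have yz: "b' \<otimes> inv (a [^] n \<otimes> z) = x \<otimes> inv z"
        using n z gc a by (simp add: inv_mult m_ac)
      have "x \<otimes> inv z \<in> generate G S" using gS n z by (meson subgroup.m_closed subgroup.m_inv_closed)
      moreover have "x \<otimes> inv z \<in> B'"
        using yz b' z(2) sub B'(1) by (metis subgroup.m_closed subgroup.m_inv_closed subsetD)
      ultimately have "x \<otimes> inv z \<in> B" using eq(1) by blast
      then have "(x \<otimes> inv z) \<otimes> (a [^] n \<otimes> z) \<in> B" using z(2) B by (meson subgroup.m_closed)
      moreover have "(x \<otimes> inv z) \<otimes> (a [^] n \<otimes> z) = b'"
        using n z gc a by (simp add: m_ac)
      ultimately show ?thesis by simp
    qed
    then show "B = B'" using sub by blast
  qed (auto simp: L_def)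
qed

end

section \<open>P. Hall's theorem on finitely generated metabelian groups\<close>

definition max_normal :: "('a, 'b) monoid_scheme \<Rightarrow> bool" where
  "max_normal G \<longleftrightarrow> max_condition {B. B \<lhd> G}"

definition metabelian :: "('a, 'b) monoid_scheme \<Rightarrow> bool" where
  "metabelian G \<longleftrightarrow> derived G (derived G (carrier G)) = {\<one>\<^bsub>G\<^esub>}"

lemma (in group_hom) preimage_normal:
  assumes "B \<lhd> H" shows "{g \<in> carrier G. h g \<in> B} \<lhd> G"
proof -
  have B: "subgroup B H" using assms by (rule normal_imp_subgroup)
  have "subgroup {g \<in> carrier G. h g \<in> B} G"
    using subgroup.one_closed[OF B] subgroup.m_closed[OF B] subgroup.m_inv_closed[OF B]
    by (intro G.subgroupI) auto
  then show ?thesis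
    using normal.inv_op_closed2[OF assms] by (intro G.normal_invI) auto
qed

context group
begin

lemma conj_mem: "\<lbrakk>N \<lhd> G; g \<in> carrier G; a \<in> N\<rbrakk> \<Longrightarrow> g \<otimes> a \<otimes> inv g \<in> N"
  by (rule normal.inv_op_closed2)

text \<open>From [gh, y] = (g [h, y] g^-1) [g, y]; normality of \<open>N\<close> absorbs the
  conjugation.\<close>

lemma centralizer_mod_subgroup:
  assumes "N \<lhd> G" "y \<in> carrier G"
  shows "subgroup {g \<in> carrier G. commutator G g y \<in> N} G"
proof (rule subgroupI)
  have N: "subgroup N G" using assms(1) by (rule normal_imp_subgroup)
  show "{g \<in> carrier G. commutator G g y \<in> N} \<noteq> {}"
    using subgroup.one_closed[OF N] assms(2) by (auto simp: commutator_def intro!: exI[of _ \<one>])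
  fix g assume "g \<in> {g \<in> carrier G. commutator G g y \<in> N}"
  then have g: "g \<in> carrier G" "commutator G g y \<in> N" by auto
  have "commutator G (inv g) y = inv g \<otimes> inv (commutator G g y) \<otimes> inv (inv g)"
    using g(1) assms(2) by (simp add: commutator_def inv_mult_group m_assoc)
  also have "\<dots> \<in> N" using g by (intro conj_mem[OF assms(1)] subgroup.m_inv_closed[OF N]) auto
  finally show "inv g \<in> {g \<in> carrier G. commutator G g y \<in> N}" using g by simp
  fix h assume "h \<in> {g \<in> carrier G. commutator G g y \<in> N}"
  then have h: "h \<in> carrier G" "commutator G h y \<in> N" by auto
  have "commutator G (g \<otimes> h) y = (g \<otimes> commutator G h y \<otimes> inv g) \<otimes> commutator G g y"
    using g(1) h(1) assms(2) by (simp add: commutator_def inv_mult_group m_assoc)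
  also have "\<dots> \<in> N" using g h by (intro subgroup.m_closed[OF N] conj_mem[OF assms(1)]) auto
  finally show "g \<otimes> h \<in> {g \<in> carrier G. commutator G g y \<in> N}" using g h by simp
qed auto

lemma inv_commutator:
  "\<lbrakk>x \<in> carrier G; y \<in> carrier G\<rbrakk> \<Longrightarrow> inv (commutator G x y) = commutator G y x"
  by (simp add: commutator_def inv_mult_group m_assoc)

text \<open>One variable at a time: being central modulo \<open>N\<close> against a fixed element
  passes from the generators to the whole group, and inverting a commutator exchanges the two
  variables.\<close>

lemma derived_subset_of_generators:
  assumes "N \<lhd> G" "S \<subseteq> carrier G" "generate G S = carrier G"
    and comm: "\<And>x y. \<lbrakk>x \<in> S; y \<in> S\<rbrakk> \<Longrightarrow> commutator G x y \<in> N"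
  shows "derived G (carrier G) \<subseteq> N"
proof -
  have N: "subgroup N G" using assms(1) by (rule normal_imp_subgroup)
  have step: "commutator G g y \<in> N"
    if "\<And>x. x \<in> S \<Longrightarrow> commutator G x y \<in> N" "g \<in> carrier G" "y \<in> carrier G" for g y
  proof -
    have "generate G S \<subseteq> {g \<in> carrier G. commutator G g y \<in> N}"
      using that assms(2) by (intro generate_subgroup_incl centralizer_mod_subgroup[OF assms(1)]) auto
    then show ?thesis using that assms(3) by auto
  qed
  have "commutator G x g \<in> N" if x: "x \<in> S" and g: "g \<in> carrier G" for x g
  proof -
    have xc: "x \<in> carrier G" using x assms(2) by auto
    have "commutator G g x \<in> N" using step[of x g] comm x g xc by auto
    then have "inv (commutator G g x) \<in> N" by (rule subgroup.m_inv_closed[OF N])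
    then show ?thesis using inv_commutator[OF g xc] by simp
  qed
  then have "commutator G g h \<in> N" if "g \<in> carrier G" "h \<in> carrier G" for g h
    using step that by blast
  then show ?thesis
    unfolding derived_eq_commutator_subgroup by (intro commutator_subgroup_least[OF N])
qed

lemma metabelianI:
  assumes "derived G (derived G (carrier G)) \<subseteq> {\<one>}" shows "metabelian G"
  using assms subgroup.one_closed[OF derived_is_subgroup[OF derived_in_carrier[OF subset_refl]]]
  unfolding metabelian_def by blast

lemma metabelian_derived_commute:
  assumes "metabelian G" "a \<in> derived G (carrier G)" "b \<in> derived G (carrier G)"
  shows "a \<otimes> b = b \<otimes> a"
proof -
  have "commutator G a b \<in> derived G (derived G (carrier G))"
    using commutator_in_commutator_subgroup[OF assms(2,3)] by (simp add: derived_eq_commutator_subgroup)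
  then have "commutator G a b = \<one>" using assms(1) by (simp add: metabelian_def)
  moreover have "a \<in> carrier G" "b \<in> carrier G"
    using assms(2,3) derived_in_carrier[OF subset_refl] by auto
  ultimately show ?thesis using commutator_eq_one_iff by blast
qed

text \<open>The products gh and hg differ by an element of G', which acts trivially on the abelian
  group G'. So G' is a module over the commutative ring Z[G/G'].\<close>

lemma metabelian_conj_commute:
  assumes "metabelian G" "a \<in> derived G (carrier G)" "g \<in> carrier G" "h \<in> carrier G"
  shows "g \<otimes> (h \<otimes> a \<otimes> inv h) \<otimes> inv g = h \<otimes> (g \<otimes> a \<otimes> inv g) \<otimes> inv h"
proof -
  have A: "derived G (carrier G) \<lhd> G" using derived_is_normal[OF normal_self] .
  have ac: "a \<in> carrier G" using assms(2) derived_in_carrier[OF subset_refl] by auto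
  define b where "b = h \<otimes> (g \<otimes> a \<otimes> inv g) \<otimes> inv h"
  have b: "b \<in> derived G (carrier G)" unfolding b_def using assms by (intro conj_mem[OF A])
  have c: "commutator G g h \<in> derived G (carrier G)"
    using commutator_in_commutator_subgroup assms(3,4) by (simp add: derived_eq_commutator_subgroup)
  have cc: "commutator G g h \<in> carrier G" and bc: "b \<in> carrier G"
    using assms ac by (auto simp: b_def)
  have "g \<otimes> (h \<otimes> a \<otimes> inv h) \<otimes> inv g = commutator G g h \<otimes> b \<otimes> inv (commutator G g h)"
    using ac assms(3,4) by (simp add: b_def commutator_def inv_mult_group m_assoc)
  also have "\<dots> = b \<otimes> commutator G g h \<otimes> inv (commutator G g h)"
    using metabelian_derived_commute[OF assms(1) c b] by simp
  also have "\<dots> = b" using cc bc by (simp add: m_assoc)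
  finally show ?thesis unfolding b_def .
qed

lemma finitely_generated_epi:
  assumes "h \<in> epi G H" "group H" "finitely_generated G"
  shows "finitely_generated H"
proof -
  interpret h: group_hom G H h
    using assms(1,2) by (simp add: group_hom_def group_hom_axioms_def epi_def)
  obtain S where "finite S" "S \<subseteq> carrier G" "generate G S = carrier G"
    using assms(3) by (auto simp: finitely_generated_def)
  then show ?thesis
    using h.generate_img[of S] assms(1) unfolding finitely_generated_def epi_def
    by (intro exI[of _ "h ` S"]) auto
qed

lemma r_coset_epi: "N \<lhd> G \<Longrightarrow> (#>) N \<in> epi G (G Mod N)"
  using normal.r_coset_hom_Mod[of N G] by (auto simp: epi_def carrier_FactGroup)

text \<open>As a module over Z[G/G'], G' is generated by the finitely many commutators of
  generators, so the basis theorem applies to it. The condition then follows from the one in G' and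
  the one in the finitely generated abelian quotient.\<close>

lemma max_normal_metabelian:
  assumes "metabelian G" "finitely_generated G"
  shows "max_normal G"
proof -
  define A where "A = derived G (carrier G)"
  define K where "K = G\<lparr>carrier := A\<rparr>"
  define conj where "conj g a = g \<otimes> a \<otimes> inv g" for g a
  have A: "A \<lhd> G" unfolding A_def by (rule derived_is_normal[OF normal_self])
  then have A_sub: "subgroup A G" by (rule normal_imp_subgroup)
  then have Ac: "a \<in> carrier G" if "a \<in> A" for a using that by (meson subgroup.mem_carrier)
  have A_comm: "a \<otimes> b = b \<otimes> a" if "a \<in> A" "b \<in> A" for a b
    using metabelian_derived_commute[OF assms(1)] that by (simp add: A_def)
  have "group K" unfolding K_def using A_sub by (rule subgroup.subgroup_is_group) (rule is_group)
  then interpret K: comm_group K by (rule group.group_comm_groupI) (simp add: K_def A_comm)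
  have conj_hom: "conj g \<in> hom K K" if "g \<in> carrier G" for g
    using that Ac conj_mem[OF A] by (intro homI) (auto simp: K_def conj_def m_assoc)
  obtain S where S: "finite S" "S \<subseteq> carrier G" "generate G S = carrier G"
    using assms(2) by (auto simp: finitely_generated_def)
  \<comment> \<open>Inverses of generators are included because invariance under conjugation by g
    alone would not give invariance under conjugation by its inverse, hence not normality.\<close>
  define T where "T = conj ` (S \<union> m_inv G ` S)"
  define C where "C = (\<lambda>(x, y). commutator G x y) ` (S \<times> S)"
  have "x \<in> carrier G" "y \<in> carrier G" if "x \<in> S" "y \<in> S" for x y using that S(2) by auto
  then have C: "finite C" "C \<subseteq> A"
    using S(1) commutator_in_commutator_subgroup by (auto simp: C_def A_def derived_eq_commutator_subgroup)
  have "max_condition {B. subgroup B K \<and> B \<subseteq> generate K C}"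
    using C by (intro K.max_condition_subgroups_generate) (auto simp: K_def)
  then have mc: "max_condition (invariant_subgroups K {} (generate K C))"
    by (simp add: invariant_subgroups_def)
  have "finite T" using S(1) by (simp add: T_def)
  moreover have "T \<subseteq> hom K K" using S(2) conj_hom by (auto simp: T_def)
  moreover have "\<sigma> (\<tau> x) = \<tau> (\<sigma> x)" if "\<sigma> \<in> T" "\<tau> \<in> T" "x \<in> carrier K" for \<sigma> \<tau> x
  proof -
    obtain g h where "\<sigma> = conj g" "\<tau> = conj h" "g \<in> carrier G" "h \<in> carrier G"
      using \<open>\<sigma> \<in> T\<close> \<open>\<tau> \<in> T\<close> S(2) by (auto simp: T_def)
    then show ?thesis using metabelian_conj_commute[OF assms(1)] \<open>x \<in> carrier K\<close>
      by (simp add: conj_def K_def A_def)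
  qed
  moreover have "subgroup (generate K C) K" using C by (intro K.generate_is_subgroup) (simp add: K_def)
  ultimately obtain Y where Y: "subgroup Y K" "generate K C \<subseteq> Y" "\<And>\<tau>. \<tau> \<in> T \<Longrightarrow> \<tau> ` Y \<subseteq> Y"
    and mcY: "max_condition (invariant_subgroups K T Y)"
    using K.max_condition_invariant_subgroups_adjoin[OF _ _ _ _ mc, of T] by auto
  have Y_sub: "subgroup Y G" using incl_subgroup[OF A_sub] Y(1) by (simp add: K_def)
  then have Yc: "y \<in> carrier G" if "y \<in> Y" for y using that by (meson subgroup.mem_carrier)
  have "conj g ` Y \<subseteq> Y" if "g \<in> generate G S" for g
    using that
  proof (induction rule: generate.induct)
    case one
    show ?case using Yc by (auto simp: conj_def)
  next
    case (incl h)
    then show ?case using Y(3) by (auto simp: T_def)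
  next
    case (inv h)
    then show ?case using Y(3) by (auto simp: T_def)
  next
    case (eng h1 h2)
    then have "h1 \<in> carrier G" "h2 \<in> carrier G" using S(2) generate_in_carrier by auto
    then have "conj (h1 \<otimes> h2) y = conj h1 (conj h2 y)" if "y \<in> Y" for y
      using Yc[OF that] by (simp add: conj_def inv_mult_group m_assoc)
    then show ?case using eng by (auto simp: image_subset_iff)
  qed
  then have Y_norm: "Y \<lhd> G" using S(3) by (intro normal_invI[OF Y_sub]) (auto simp: conj_def)
  have "C \<subseteq> Y" using Y(2) generate.incl[of _ C K] by blast
  then have "commutator G x y \<in> Y" if "x \<in> S" "y \<in> S" for x y using that by (auto simp: C_def)
  \<comment> \<open>Only here is the constructed module recognised as all of G': it is normal and
    contains the commutators of generators.\<close>
  then have "A \<subseteq> Y" unfolding A_def by (rule derived_subset_of_generators[OF Y_norm S(2,3)])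
  have "{B. B \<lhd> G \<and> B \<subseteq> A} \<subseteq> invariant_subgroups K T Y"
  proof
    fix B assume "B \<in> {B. B \<lhd> G \<and> B \<subseteq> A}"
    then have B: "B \<lhd> G" "B \<subseteq> A" by auto
    have "subgroup B K" unfolding K_def
      using subgroup_incl[OF normal_imp_subgroup[OF B(1)] A_sub B(2)] .
    moreover have "\<tau> ` B \<subseteq> B" if "\<tau> \<in> T" for \<tau>
    proof -
      obtain g where g: "\<tau> = conj g" "g \<in> S \<union> m_inv G ` S" using \<open>\<tau> \<in> T\<close> unfolding T_def by blast
      have "g \<in> carrier G" using g(2) S(2) by auto
      with g(1) show ?thesis using conj_mem[OF B(1)] by (auto simp: conj_def)
    qed
    ultimately show "B \<in> invariant_subgroups K T Y"
      using B(2) \<open>A \<subseteq> Y\<close> by (auto simp: invariant_subgroups_def)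
  qed
  with mcY have mcA: "max_condition {B. B \<lhd> G \<and> B \<subseteq> A}" by (rule max_condition_subset)
  let ?Q = "G Mod A"
  have "comm_group ?Q" unfolding A_def by (rule derived_quot_is_comm_group)
  then interpret Q: comm_group ?Q .
  interpret q: group_hom G ?Q "(#>) A"
    using normal.r_coset_hom_Mod[OF A] by unfold_locales
  obtain S' where "finite S'" "S' \<subseteq> carrier ?Q" "generate ?Q S' = carrier ?Q"
    using finitely_generated_epi[OF r_coset_epi[OF A] Q.is_group assms(2)]
    unfolding finitely_generated_def by blast
  then have mcQ: "max_condition {B. subgroup B ?Q \<and> B \<subseteq> carrier ?Q}"
    using Q.max_condition_subgroups_generate[of S'] by simp
  show ?thesis
    unfolding max_normal_def
  proof (rule max_condition_pullback2[OF mcA mcQ, of _ "\<lambda>B. B \<inter> A" "\<lambda>B. (#>) A ` B"])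
    fix B assume "B \<in> {B. B \<lhd> G}"
    then have B: "B \<lhd> G" by simp
    then show "B \<inter> A \<in> {B. B \<lhd> G \<and> B \<subseteq> A}" using normal_subgroup_intersect[OF B A] by simp
    have "subgroup ((#>) A ` B) ?Q" using q.subgroup_img_is_subgroup[OF normal_imp_subgroup[OF B]] .
    then show "(#>) A ` B \<in> {B. subgroup B ?Q \<and> B \<subseteq> carrier ?Q}" using subgroup.subset by blast
  next
    fix B B' assume "B \<in> {B. B \<lhd> G}" "B' \<in> {B. B \<lhd> G}" and sub: "B \<subseteq> B'"
      and eq: "B \<inter> A = B' \<inter> A" "(#>) A ` B = (#>) A ` B'"
    then have B: "subgroup B G" and B': "subgroup B' G" by (auto dest: normal_imp_subgroup)
    have "b' \<in> B" if b': "b' \<in> B'" for b'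
    proof -
      obtain b where b: "b \<in> B" "A #> b' = A #> b" using eq(2) b' by blast
      have c: "b \<in> carrier G" "b' \<in> carrier G" using b(1) b' B B' by (meson subgroup.mem_carrier)+
      have "b' \<in> A #> b" using b(2) rcos_self[OF c(2) A_sub] by simp
      then have "b' \<otimes> inv b \<in> A"
        using subgroup.rcos_module_imp[OF A_sub is_group c(1)] by simp
      moreover have "b' \<otimes> inv b \<in> B'"
        using b' b(1) sub B' by (meson subgroup.m_closed subgroup.m_inv_closed subsetD)
      ultimately have "b' \<otimes> inv b \<in> B" using eq(1) by blast
      then have "(b' \<otimes> inv b) \<otimes> b \<in> B" using b(1) B by (meson subgroup.m_closed)
      then show ?thesis using c by (simp add: m_assoc)
    qed
    then show "B = B'" using sub by blast
  qed (auto)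
qed

lemma max_normal_epi:
  assumes "max_normal G" "h \<in> epi G H" "group H"
  shows "max_normal H"
proof -
  interpret h: group_hom G H h
    using assms(2,3) by (simp add: group_hom_def group_hom_axioms_def epi_def)
  have surj: "h ` carrier G = carrier H" using assms(2) by (simp add: epi_def)
  show ?thesis
    unfolding max_normal_def
  proof (rule max_condition_pullback[where \<phi> = "\<lambda>B. {g \<in> carrier G. h g \<in> B}"])
    show "max_condition {B. B \<lhd> G}" using assms(1) by (simp add: max_normal_def)
    fix B assume "B \<in> {B. B \<lhd> H}"
    then show "{g \<in> carrier G. h g \<in> B} \<in> {B. B \<lhd> G}" using h.preimage_normal by simp
  next
    fix B B' assume "B \<in> {B. B \<lhd> H}" "B' \<in> {B. B \<lhd> H}" "B \<subseteq> B'"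
      and eq: "{g \<in> carrier G. h g \<in> B} = {g \<in> carrier G. h g \<in> B'}"
    then have "B' \<subseteq> carrier H" by (auto dest: normal_imp_subgroup subgroup.subset)
    then have "B' \<subseteq> B" using eq surj by (smt (verit) imageE mem_Collect_eq subset_iff)
    then show "B = B'" using \<open>B \<subseteq> B'\<close> by blast
  qed auto
qed

end

section \<open>Commuting subgroups of metabelian groups\<close>

definition commuting_family :: "('a, 'b) monoid_scheme \<Rightarrow> nat \<Rightarrow> (nat \<Rightarrow> 'a set) \<Rightarrow> bool" where
  "commuting_family G N H \<longleftrightarrow> (\<forall>k<N. subgroup (H k) G) \<and>
     (\<forall>k<N. \<forall>l<N. k \<noteq> l \<longrightarrow> (\<forall>x\<in>H k. \<forall>y\<in>H l. x \<otimes>\<^bsub>G\<^esub> y = y \<otimes>\<^bsub>G\<^esub> x))"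

text \<open>\<open>C\<close> holds the admissible classes, so that one Noetherian induction serves
  both stages: \<open>UNIV\<close> when the class is to be found, a singleton when it is prescribed.
  Both \<open>N\<close> and \<open>c\<close> are uniform in the family.\<close>

definition weakly_nilpotent :: "nat set \<Rightarrow> ('a, 'b) monoid_scheme \<Rightarrow> bool" where
  "weakly_nilpotent C G \<longleftrightarrow> (\<exists>N\<ge>1. \<exists>c\<in>C. \<forall>H. commuting_family G N H \<longrightarrow>
     (\<exists>k<N. lower_central G (H k) c \<subseteq> {\<one>\<^bsub>G\<^esub>}))"

definition normally_irreducible :: "('a, 'b) monoid_scheme \<Rightarrow> bool" where
  "normally_irreducible G \<longleftrightarrow>
     (\<forall>B1 B2. B1 \<lhd> G \<and> B2 \<lhd> G \<and> B1 \<inter> B2 = {\<one>\<^bsub>G\<^esub>} \<longrightarrow> B1 = {\<one>\<^bsub>G\<^esub>} \<or> B2 = {\<one>\<^bsub>G\<^esub>})"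

lemma commuting_familyD:
  "\<lbrakk>commuting_family G N H; k < N; l < N; k \<noteq> l; x \<in> H k; y \<in> H l\<rbrakk>
    \<Longrightarrow> x \<otimes>\<^bsub>G\<^esub> y = y \<otimes>\<^bsub>G\<^esub> x"
  unfolding commuting_family_def by blast

lemma (in group_hom) commuting_family_img:
  assumes "commuting_family G N K" shows "commuting_family H N (\<lambda>k. h ` K k)"
proof -
  have sub: "subgroup (K k) G" if "k < N" for k using assms that by (simp add: commuting_family_def)
  have "h x \<otimes>\<^bsub>H\<^esub> h y = h y \<otimes>\<^bsub>H\<^esub> h x"
    if "k < N" "l < N" "k \<noteq> l" "x \<in> K k" "y \<in> K l" for k l x y
  proof -
    have "x \<in> carrier G" "y \<in> carrier G" "x \<otimes>\<^bsub>G\<^esub> y = y \<otimes>\<^bsub>G\<^esub> x"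
      using assms that subgroup.mem_carrier[OF sub] by (auto simp: commuting_family_def)
    then show ?thesis by (metis hom_mult)
  qed
  then show ?thesis using sub subgroup_img_is_subgroup by (auto simp: commuting_family_def)
qed

lemma commuting_family_subset:
  "\<lbrakk>commuting_family G N H; inj_on \<iota> {..<M}; \<And>i. i < M \<Longrightarrow> \<iota> i < N\<rbrakk>
    \<Longrightarrow> commuting_family G M (\<lambda>i. H (\<iota> i))"
  unfolding commuting_family_def inj_on_def by (metis lessThan_iff)

context group
begin

text \<open>Noetherian induction over normal subgroups: the property of \<open>B\<close> proved here passes from two
  normal subgroups to their intersection, because deleting from a commuting family the members that are
  good for one of them leaves a family on which the other one can be tested.\<close>
lemma weakly_nilpotent_if_irreducible_quotients:
  assumes "max_normal G" and C: "\<And>c d. \<lbrakk>c \<in> C; d \<in> C\<rbrakk> \<Longrightarrow> max c d \<in> C"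
    and irred: "\<And>B. \<lbrakk>B \<lhd> G; normally_irreducible (G Mod B)\<rbrakk> \<Longrightarrow> weakly_nilpotent C (G Mod B)"
  shows "weakly_nilpotent C G"
proof -
  \<comment> \<open>\<open>P B\<close> tests commuting families of \<open>G\<close>, not of the
    quotient: families of \<open>G\<close> have commuting images, whereas subgroups that commute
    modulo \<open>B\<close> need not lift to commuting ones.\<close>
  define P where "P B \<longleftrightarrow> (\<exists>N\<ge>1. \<exists>c\<in>C. \<forall>H. commuting_family G N H \<longrightarrow>
     (\<exists>k<N. lower_central G (H k) c \<subseteq> B))" for B
  have P_inter: "P (B1 \<inter> B2)" if P1: "P B1" and P2: "P B2" for B1 B2
  proof -
    obtain N1 c1 where 1: "N1 \<ge> 1" "c1 \<in> C"
      "\<And>H. commuting_family G N1 H \<Longrightarrow> \<exists>k<N1. lower_central G (H k) c1 \<subseteq> B1"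
      using P1 unfolding P_def by blast
    obtain N2 c2 where 2: "N2 \<ge> 1" "c2 \<in> C"
      "\<And>H. commuting_family G N2 H \<Longrightarrow> \<exists>k<N2. lower_central G (H k) c2 \<subseteq> B2"
      using P2 unfolding P_def by blast
    define c where "c = max c1 c2"
    have "\<exists>k<N1 + N2. lower_central G (H k) c \<subseteq> B1 \<inter> B2" if H: "commuting_family G (N1 + N2) H" for H
    proof (rule ccontr)
      assume bad: "\<not> ?thesis"
      \<comment> \<open>If \<open>M\<close> members were bad at \<open>c\<close>, they would form a
        family that refutes \<open>good\<close>, because a smaller index \<open>d\<close> gives a
        larger lower central term.\<close>
      have few: "card {k. k < N1 + N2 \<and> \<not> lower_central G (H k) c \<subseteq> B} < M"
        if good: "\<And>H. commuting_family G M H \<Longrightarrow> \<exists>k<M. lower_central G (H k) d \<subseteq> B" and "d \<le> c"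
        for B d M
      proof (rule ccontr)
        let ?K = "{k. k < N1 + N2 \<and> \<not> lower_central G (H k) c \<subseteq> B}"
        assume "\<not> card ?K < M"
        then obtain K where K: "K \<subseteq> ?K" "card K = M" by (meson not_less obtain_subset_with_card_n)
        have "finite K" using K(1) by (rule finite_subset) simp
        then obtain \<iota> where \<iota>: "bij_betw \<iota> {..<M} K"
          using K(2) ex_bij_betw_nat_finite[of K] by (auto simp: atLeast0LessThan)
        then have mem: "\<iota> i \<in> ?K" if "i < M" for i using K(1) that bij_betwE by blast
        have "commuting_family G M (\<lambda>i. H (\<iota> i))"
          using commuting_family_subset[OF H bij_betw_imp_inj_on[OF \<iota>]] mem by blast
        then obtain i where i: "i < M" "lower_central G (H (\<iota> i)) d \<subseteq> B" using good[of "\<lambda>i. H (\<iota> i)"] by blast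
        have "subgroup (H (\<iota> i)) G" using H mem[OF i(1)] by (simp add: commuting_family_def)
        then have "lower_central G (H (\<iota> i)) c \<subseteq> B"
          using lower_central_antimono[OF _ \<open>d \<le> c\<close>] i(2) by blast
        then show False using mem[OF i(1)] by simp
      qed
      let ?K1 = "{k. k < N1 + N2 \<and> \<not> lower_central G (H k) c \<subseteq> B1}"
      let ?K2 = "{k. k < N1 + N2 \<and> \<not> lower_central G (H k) c \<subseteq> B2}"
      have "card ?K1 < N1" using few[OF 1(3)] by (simp add: c_def)
      moreover have "card ?K2 < N2" using few[OF 2(3)] by (simp add: c_def)
      moreover have "{..<N1 + N2} \<subseteq> ?K1 \<union> ?K2" using bad by auto
      then have "card {..<N1 + N2} \<le> card (?K1 \<union> ?K2)" by (intro card_mono) auto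
      ultimately show False using card_Un_le[of ?K1 ?K2] by simp
    qed
    moreover have "c \<in> C" using C 1(2) 2(2) by (simp add: c_def)
    ultimately show ?thesis unfolding P_def using 1(1) by (intro exI[of _ "N1 + N2"]) auto
  qed
  have "P {\<one>}"
  proof (rule ccontr)
    assume "\<not> P {\<one>}"
    then have ne: "{B. B \<lhd> G \<and> \<not> P B} \<noteq> {}" using one_is_normal by blast
    obtain B where B: "B \<lhd> G" "\<not> P B" and
      B_max: "\<And>B'. \<lbrakk>B' \<lhd> G; \<not> P B'; B \<subseteq> B'\<rbrakk> \<Longrightarrow> B' = B"
      using max_condition_maximal[OF assms(1)[unfolded max_normal_def] _ ne] by blast
    interpret Q: group "G Mod B" using B(1) by (rule normal.factorgroup_is_group)
    interpret q: group_hom G "G Mod B" "(#>) B"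
      using normal.r_coset_hom_Mod[OF B(1)] by unfold_locales
    have Bsub: "subgroup B G" using B(1) by (rule normal_imp_subgroup)
    have surj: "(#>) B ` carrier G = carrier (G Mod B)" by (simp add: carrier_FactGroup)
    have coset_B: "B #> g = B \<longleftrightarrow> g \<in> B" if "g \<in> carrier G" for g
      using rcos_self[OF that Bsub] coset_join2[OF that Bsub] by auto
    \<comment> \<open>Nontrivial normal subgroups of the quotient pull back to normal subgroups
      strictly above \<open>B\<close>, which satisfy \<open>P\<close> by maximality. If they met in
      \<open>B\<close>, then \<open>P B\<close> would follow.\<close>
    have "normally_irreducible (G Mod B)"
      unfolding normally_irreducible_def
    proof (intro allI impI, elim conjE)
      fix K1 K2 assume K: "K1 \<lhd> G Mod B" "K2 \<lhd> G Mod B" "K1 \<inter> K2 = {\<one>\<^bsub>G Mod B\<^esub>}"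
      let ?L = "\<lambda>K. {g \<in> carrier G. B #> g \<in> K}"
      have L: "?L K \<lhd> G" "B \<subseteq> ?L K" if "K \<lhd> G Mod B" for K
      proof -
        show "?L K \<lhd> G" using that by (rule q.preimage_normal)
        have "B \<in> K" using subgroup.one_closed[OF normal_imp_subgroup[OF that]] by simp
        moreover have "B #> b = B" "b \<in> carrier G" if "b \<in> B" for b
          using that coset_B subgroup.mem_carrier[OF Bsub] by blast+
        ultimately show "B \<subseteq> ?L K" by (simp add: subset_iff)
      qed
      have L_eq: "K = {\<one>\<^bsub>G Mod B\<^esub>}" if "K \<lhd> G Mod B" "?L K = B" for K
      proof -
        have "k = B" if "k \<in> K" for k
        proof -
          have "k \<in> carrier (G Mod B)"
            using normal_imp_subgroup[OF \<open>K \<lhd> G Mod B\<close>] \<open>k \<in> K\<close> by (rule subgroup.mem_carrier)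
          then have "k \<in> (#>) B ` carrier G" unfolding surj .
          then obtain g where "g \<in> carrier G" "k = B #> g" by blast
          then have "g \<in> B" using \<open>?L K = B\<close> that by blast
          then show ?thesis using \<open>k = B #> g\<close> coset_B \<open>g \<in> carrier G\<close> by simp
        qed
        moreover have "B \<in> K" using subgroup.one_closed[OF normal_imp_subgroup[OF that(1)]] by simp
        ultimately have "K = {B}" by blast
        then show ?thesis by simp
      qed
      have "?L K1 \<inter> ?L K2 \<subseteq> B"
      proof
        fix g assume "g \<in> ?L K1 \<inter> ?L K2"
        then have "g \<in> carrier G" "B #> g \<in> K1 \<inter> K2" by auto
        then show "g \<in> B" using K(3) coset_B by simp
      qed
      with L(2)[OF K(1)] L(2)[OF K(2)] have "?L K1 \<inter> ?L K2 = B" by (simp add: subset_antisym)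
      then have "\<not> P (?L K1) \<or> \<not> P (?L K2)" using B(2) P_inter[of "?L K1" "?L K2"] by auto
      then have "?L K1 = B \<or> ?L K2 = B"
        using B_max[OF L(1)[OF K(1)] _ L(2)[OF K(1)]] B_max[OF L(1)[OF K(2)] _ L(2)[OF K(2)]] by argo
      then show "K1 = {\<one>\<^bsub>G Mod B\<^esub>} \<or> K2 = {\<one>\<^bsub>G Mod B\<^esub>}"
        using L_eq[OF K(1)] L_eq[OF K(2)] by argo
    qed
    then obtain N c where N: "N \<ge> 1" "c \<in> C"
      "\<And>H. commuting_family (G Mod B) N H \<Longrightarrow> \<exists>k<N. lower_central (G Mod B) (H k) c \<subseteq> {\<one>\<^bsub>G Mod B\<^esub>}"
      using irred[OF B(1)] unfolding weakly_nilpotent_def by blast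
    have "\<exists>k<N. lower_central G (H k) c \<subseteq> B" if H: "commuting_family G N H" for H
    proof -
      obtain k where k: "k < N" "lower_central (G Mod B) ((#>) B ` H k) c \<subseteq> {\<one>\<^bsub>G Mod B\<^esub>}"
        using N(3)[OF q.commuting_family_img[OF H]] by blast
      have Hk: "subgroup (H k) G" using H k(1) by (simp add: commuting_family_def)
      have "(#>) B ` lower_central G (H k) c \<subseteq> {B}"
        using k(2) q.lower_central_img[OF Hk] by simp
      moreover have "lower_central G (H k) c \<subseteq> carrier G"
        using lower_central_is_subgroup[OF Hk] by (rule subgroup.subset)
      moreover have "g \<in> B" if "g \<in> lower_central G (H k) c" for g
      proof -
        have "g \<in> carrier G" "B #> g = B" using that calculation by auto
        then show ?thesis using coset_B by simp
      qed
      ultimately show ?thesis using k(1) by blast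
    qed
    then have "P B" unfolding P_def using N by blast
    then show False using B(2) by simp
  qed
  then show ?thesis by (simp add: P_def weakly_nilpotent_def)
qed

end

section \<open>The action of a metabelian group on its derived subgroup\<close>

locale metabelian_group = group +
  assumes metabelian: "metabelian G"
begin

abbreviation A where "A \<equiv> derived G (carrier G)"

lemma A_normal: "A \<lhd> G"
  using derived_is_normal[OF normal_self] .

lemma A_subgroup: "subgroup A G"
  using A_normal by (rule normal_imp_subgroup)

lemma A_carrier [simp]: "a \<in> A \<Longrightarrow> a \<in> carrier G"
  using A_subgroup by (rule subgroup.mem_carrier)

lemma comm_group_A: "comm_group (G\<lparr>carrier := A\<rparr>)"
  using subgroup.subgroup_is_group[OF A_subgroup is_group]
  by (rule group.group_comm_groupI) (simp add: metabelian_derived_commute[OF metabelian])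

lemma A_comm: "\<lbrakk>a \<in> A; b \<in> A\<rbrakk> \<Longrightarrow> a \<otimes> b = b \<otimes> a"
  by (rule metabelian_derived_commute[OF metabelian])

lemma commutator_in_normal:
  assumes "N \<lhd> G" "g \<in> carrier G" "a \<in> N" shows "commutator G g a \<in> N"
proof -
  have N: "subgroup N G" using assms(1) by (rule normal_imp_subgroup)
  have "g \<otimes> a \<otimes> inv g \<otimes> inv a \<in> N"
    using conj_mem[OF assms] subgroup.m_inv_closed[OF N assms(3)] by (rule subgroup.m_closed[OF N])
  then show ?thesis by (simp add: commutator_def)
qed

text \<open>Written additively on \<open>A\<close>, the map a \<mapsto> [g, a] is the action of the
  ring element g - 1. This is the source of its additivity here, and of its compatibility with
  conjugation and with other such maps below.\<close>

lemma commutator_mult_right: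
  assumes "g \<in> carrier G" "a \<in> A" "b \<in> A"
  shows "commutator G g (a \<otimes> b) = commutator G g a \<otimes> commutator G g b"
proof -
  have c: "commutator G g b \<in> A" using commutator_in_normal[OF A_normal assms(1,3)] .
  have "commutator G g (a \<otimes> b) = commutator G g a \<otimes> (a \<otimes> commutator G g b \<otimes> inv a)"
    using assms by (simp add: commutator_def inv_mult_group m_assoc)
  also have "a \<otimes> commutator G g b = commutator G g b \<otimes> a" using A_comm[OF assms(2) c] .
  finally show ?thesis using assms(2) c by (simp add: m_assoc)
qed

lemma commutator_hom: "g \<in> carrier G \<Longrightarrow> commutator G g \<in> hom (G\<lparr>carrier := A\<rparr>) (G\<lparr>carrier := A\<rparr>)"
  by (rule homI) (simp_all add: commutator_mult_right commutator_in_normal[OF A_normal])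

lemma commutator_conj:
  assumes "g \<in> carrier G" "q \<in> carrier G" "a \<in> A"
  shows "commutator G q (g \<otimes> a \<otimes> inv g) = g \<otimes> commutator G q a \<otimes> inv g"
proof -
  have "commutator G q (g \<otimes> a \<otimes> inv g) = (q \<otimes> (g \<otimes> a \<otimes> inv g) \<otimes> inv q) \<otimes> inv (g \<otimes> a \<otimes> inv g)"
    using assms by (simp add: commutator_def m_assoc)
  also have "\<dots> = (g \<otimes> (q \<otimes> a \<otimes> inv q) \<otimes> inv g) \<otimes> inv (g \<otimes> a \<otimes> inv g)"
    using metabelian_conj_commute[OF metabelian assms(3,2,1)] by simp
  also have "\<dots> = g \<otimes> commutator G q a \<otimes> inv g"
    using assms by (simp add: commutator_def inv_mult_group m_assoc)
  finally show ?thesis .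
qed

lemma commutator_inv_right:
  assumes "q \<in> carrier G" "a \<in> A"
  shows "commutator G q (inv a) = inv (commutator G q a)"
proof -
  have "commutator G q a \<otimes> commutator G q (inv a) = commutator G q \<one>"
    using commutator_mult_right[OF assms(1,2) subgroup.m_inv_closed[OF A_subgroup assms(2)]] assms by simp
  also have "\<dots> = \<one>" using assms by (simp add: commutator_def)
  finally show ?thesis using assms by (metis A_carrier commutator_closed inv_closed inv_comm inv_equality)
qed

lemma commutator_commute:
  assumes "g \<in> carrier G" "h \<in> carrier G" "a \<in> A"
  shows "commutator G g (commutator G h a) = commutator G h (commutator G g a)"
proof -
  have h: "h \<otimes> a \<otimes> inv h \<in> A" using conj_mem[OF A_normal assms(2,3)] .
  have g: "commutator G g a \<in> A" using commutator_in_normal[OF A_normal assms(1,3)] .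
  have ia: "inv a \<in> A" using subgroup.m_inv_closed[OF A_subgroup assms(3)] .
  have "commutator G g (commutator G h a) = commutator G g ((h \<otimes> a \<otimes> inv h) \<otimes> inv a)"
    using assms by (simp add: commutator_def)
  also have "\<dots> = h \<otimes> commutator G g a \<otimes> inv h \<otimes> inv (commutator G g a)"
    using commutator_mult_right[OF assms(1) h ia] commutator_conj[OF assms(2,1,3)]
      commutator_inv_right[OF assms(1,3)] by simp
  also have "\<dots> = commutator G h (commutator G g a)" by (simp add: commutator_def)
  finally show ?thesis .
qed

lemma commutator_funpow_in_normal:
  "\<lbrakk>N \<lhd> G; g \<in> carrier G; a \<in> N\<rbrakk> \<Longrightarrow> (commutator G g ^^ n) a \<in> N"
  by (induction n) (auto intro: commutator_in_normal)

lemma commutator_funpow_commute: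
  "\<lbrakk>g \<in> carrier G; h \<in> carrier G; a \<in> A\<rbrakk> \<Longrightarrow>
    commutator G g ((commutator G h ^^ n) a) = (commutator G h ^^ n) (commutator G g a)"
proof (induction n)
  case (Suc n)
  have "(commutator G h ^^ n) a \<in> A" using Suc.prems by (intro commutator_funpow_in_normal[OF A_normal])
  then show ?case using Suc commutator_commute[of g h "(commutator G h ^^ n) a"] by simp
qed simp

text \<open>Fitting's lemma for the endomorphism \<open>a \<mapsto> [q, a]\<close> of the Noetherian module \<open>G'\<close>: the kernel and the
  image of a high power of it are normal subgroups that meet trivially.\<close>
lemma nilpotent_if_fixed_point:
  assumes "max_normal G" "normally_irreducible G"
    and q: "q \<in> carrier G" and a: "a \<in> A" "a \<noteq> \<one>" "commutator G q a = \<one>"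
  shows "\<exists>n. \<forall>b\<in>A. (commutator G q ^^ n) b = \<one>"
proof -
  interpret K: comm_group "G\<lparr>carrier := A\<rparr>" by (rule comm_group_A)
  let ?D = "\<lambda>n. commutator G q ^^ n"
  have D_hom: "?D n \<in> hom (G\<lparr>carrier := A\<rparr>) (G\<lparr>carrier := A\<rparr>)" for n
    using commutator_hom[OF q] by (rule K.hom_funpow)
  have D_one: "?D n \<one> = \<one>" for n using hom_one[OF D_hom K.is_group K.is_group] by simp
  have D_mult: "?D n (x \<otimes> y) = ?D n x \<otimes> ?D n y" if "x \<in> A" "y \<in> A" for n x y
    using hom_mult[OF D_hom] that by simp
  have D_A: "?D n x \<in> A" if "x \<in> A" for n x using hom_in_carrier[OF D_hom] that by simp
  have D_conj: "?D n (g \<otimes> x \<otimes> inv g) = g \<otimes> ?D n x \<otimes> inv g" if "g \<in> carrier G" "x \<in> A" for n g x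
    using that by (induction n) (simp_all add: commutator_conj[OF _ q] D_A)
  have D_inv: "?D n (inv x) = inv (?D n x)" if "x \<in> A" for n x
    using that by (induction n) (simp_all add: commutator_inv_right[OF q] D_A)
  define Ker where "Ker n = {x \<in> A. ?D n x = \<one>}" for n
  define Im where "Im n = ?D n ` A" for n
  have Ker: "Ker n \<lhd> G" for n
  proof (rule normal_invI)
    show "subgroup (Ker n) G"
    proof (rule subgroupI)
      show "Ker n \<noteq> {}" using subgroup.one_closed[OF A_subgroup] D_one by (auto simp: Ker_def)
    qed (auto simp: Ker_def D_mult D_inv subgroup.m_closed[OF A_subgroup] subgroup.m_inv_closed[OF A_subgroup])
    show "g \<otimes> x \<otimes> inv g \<in> Ker n" if "g \<in> carrier G" "x \<in> Ker n" for g x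
      using that D_conj conj_mem[OF A_normal] by (auto simp: Ker_def)
  qed
  have Im: "Im n \<lhd> G" for n
  proof (rule normal_invI)
    have "subgroup A (G\<lparr>carrier := A\<rparr>)" using K.subgroup_self by simp
    then show "subgroup (Im n) G"
      using incl_subgroup[OF A_subgroup K.hom_image_subgroup[OF D_hom]] by (simp add: Im_def)
    fix g x assume "g \<in> carrier G" "x \<in> Im n"
    then obtain y where "y \<in> A" "x = ?D n y" by (auto simp: Im_def)
    then have "g \<otimes> x \<otimes> inv g = ?D n (g \<otimes> y \<otimes> inv g)" using D_conj \<open>g \<in> carrier G\<close> by simp
    then show "g \<otimes> x \<otimes> inv g \<in> Im n"
      using conj_mem[OF A_normal \<open>g \<in> carrier G\<close> \<open>y \<in> A\<close>] by (simp add: Im_def)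
  qed
  have Ker_Suc: "Ker n \<subseteq> Ker (Suc n)" for n using D_one[of 1] by (auto simp: Ker_def)
  have Ker_mono: "Ker n \<subseteq> Ker m" if "n \<le> m" for n m
    using lift_Suc_mono_le[of Ker, OF Ker_Suc that] .
  obtain n0 where n0: "\<And>m. m \<ge> n0 \<Longrightarrow> Ker m = Ker n0"
    using max_conditionD[OF assms(1)[unfolded max_normal_def], of Ker] Ker Ker_Suc by auto
  \<comment> \<open>The successor makes \<open>n\<close> positive, so that the given element
    \<open>a\<close>, which is killed by the first power, lies in \<open>Ker n\<close>.\<close>
  define n where "n = Suc n0"
  have "x = \<one>" if "x \<in> Ker n" "x \<in> Im n" for x
  proof -
    obtain y where y: "y \<in> A" "x = ?D n y" using \<open>x \<in> Im n\<close> by (auto simp: Im_def)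
    \<comment> \<open>An element of both kernel and image has the form D^n y with D^(2n) y trivial;
      stability of the kernels makes D^n y trivial already.\<close>
    then have "y \<in> Ker (n + n)" using \<open>x \<in> Ker n\<close> by (auto simp: Ker_def funpow_add)
    then have "y \<in> Ker n" using n0[of n] n0[of "n + n"] by (simp add: n_def)
    then show ?thesis using y by (simp add: Ker_def)
  qed
  moreover have "\<one> \<in> Ker n" "\<one> \<in> Im n" 
    using normal_imp_subgroup[OF Ker] normal_imp_subgroup[OF Im] by (simp_all add: subgroup.one_closed)
  ultimately have "Ker n \<inter> Im n = {\<one>}" by blast
  then have "Ker n = {\<one>} \<or> Im n = {\<one>}"
    using assms(2) Ker[of n] Im[of n] unfolding normally_irreducible_def by metis
  moreover have "a \<in> Ker n" using Ker_mono[of 1 n] a by (auto simp: Ker_def n_def)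
  ultimately have "Im n = {\<one>}" using a(2) by blast
  then show ?thesis by (auto simp: Im_def)
qed

text \<open>In module terms, the elements of G' killed by all products of \<open>c\<close> operators
  q - 1 with q in \<open>I\<close>: an upper central series of G' relative to
  \<open>I\<close>.\<close>

primrec annihilated :: "'a set \<Rightarrow> nat \<Rightarrow> 'a set" where
  "annihilated I 0 = {\<one>}"
| "annihilated I (Suc c) = {a \<in> A. \<forall>q\<in>I. commutator G q a \<in> annihilated I c}"

lemma annihilated_normal: "I \<subseteq> carrier G \<Longrightarrow> annihilated I c \<lhd> G"
proof (induction c)
  case 0
  show ?case using one_is_normal by simp
next
  case (Suc c)
  have q: "q \<in> carrier G" if "q \<in> I" for q using that Suc.prems by auto
  have N: "annihilated I c \<lhd> G" using Suc by simp
  then have N_sub: "subgroup (annihilated I c) G" by (rule normal_imp_subgroup)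
  show ?case
  proof (rule normal_invI)
    show "subgroup (annihilated I (Suc c)) G"
    proof (rule subgroupI)
      have "commutator G q \<one> \<in> annihilated I c" if "q \<in> I" for q
        using q[OF that] subgroup.one_closed[OF N_sub] by (simp add: commutator_def)
      then show "annihilated I (Suc c) \<noteq> {}" using subgroup.one_closed[OF A_subgroup] by auto
    qed (auto simp: q commutator_mult_right commutator_inv_right subgroup.m_closed[OF A_subgroup]
        subgroup.m_inv_closed[OF A_subgroup] subgroup.m_closed[OF N_sub] subgroup.m_inv_closed[OF N_sub])
    show "g \<otimes> x \<otimes> inv g \<in> annihilated I (Suc c)" if "g \<in> carrier G" "x \<in> annihilated I (Suc c)" for g x
      using that q conj_mem[OF A_normal] conj_mem[OF N] by (auto simp: commutator_conj)
  qed
qed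

lemma annihilated_Suc_subset: "I \<subseteq> carrier G \<Longrightarrow> annihilated I c \<subseteq> annihilated I (Suc c)"
proof (induction c)
  case 0
  then have "commutator G q \<one> = \<one>" if "q \<in> I" for q using that by (auto simp: commutator_def)
  then show ?case using subgroup.one_closed[OF A_subgroup] by simp
next
  case (Suc c)
  then show ?case by (auto simp: subset_iff)
qed

text \<open>Among the elements outside the last annihilator pick one with a maximal stabiliser modulo it:
  by nilpotency all of \<open>I\<close> lies in that stabiliser.\<close>
lemma annihilated_eq_derived:
  assumes "max_normal G" "I \<subseteq> carrier G"
    and nil: "\<And>q. q \<in> I \<Longrightarrow> \<exists>n. \<forall>b\<in>A. (commutator G q ^^ n) b = \<one>"
  shows "\<exists>c. annihilated I c = A"
proof -
  have mc: "max_condition {B. B \<lhd> G}" using assms(1) by (simp add: max_normal_def)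
  have Z_norm: "annihilated I c \<lhd> G" for c using assms(2) by (rule annihilated_normal)
  have Z_A: "annihilated I c \<subseteq> A" for c using subgroup.one_closed[OF A_subgroup] by (cases c) auto
  obtain c where c_max: "\<And>d. d \<ge> c \<Longrightarrow> annihilated I d = annihilated I c"
    using max_conditionD[OF mc, of "annihilated I"] Z_norm annihilated_Suc_subset[OF assms(2)] by blast
  have c: "annihilated I (Suc c) = annihilated I c" by (rule c_max) simp
  let ?Z = "annihilated I c"
  have one_Z: "\<one> \<in> ?Z" using normal_imp_subgroup[OF Z_norm] by (rule subgroup.one_closed)
  define Stab where "Stab a = {h \<in> carrier G. commutator G h a \<in> ?Z}" for a
  have Stab: "Stab a \<lhd> G" if "a \<in> A" for a
  proof (rule derived_subset_normal)
    show "subgroup (Stab a) G" unfolding Stab_def using that by (intro centralizer_mod_subgroup Z_norm) simp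
    have "commutator G h a = \<one>" if "h \<in> A" for h
      using A_comm[OF that \<open>a \<in> A\<close>] commutator_eq_one_iff that \<open>a \<in> A\<close> by simp
    then show "A \<subseteq> Stab a" using one_Z by (auto simp: Stab_def)
  qed
  have "A - ?Z = {}"
  proof (rule ccontr)
    assume ne: "A - ?Z \<noteq> {}"
    have "Stab ` (A - ?Z) \<subseteq> {B. B \<lhd> G}" using Stab by blast
    then have "\<exists>B\<in>Stab ` (A - ?Z). \<forall>B'\<in>Stab ` (A - ?Z). B \<subseteq> B' \<longrightarrow> B' = B"
      using ne by (intro max_condition_maximal[OF mc]) simp_all
    then obtain B where B: "B \<in> Stab ` (A - ?Z)" "\<forall>B'\<in>Stab ` (A - ?Z). B \<subseteq> B' \<longrightarrow> B' = B" ..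
    from B(1) obtain a where a: "a \<in> A" "a \<notin> ?Z" "B = Stab a" by blast
    have a_max: "Stab b = Stab a" if "b \<in> A" "b \<notin> ?Z" "Stab a \<subseteq> Stab b" for b
      using bspec[OF B(2), of "Stab b"] that a(3) by simp
    have "commutator G h a \<in> ?Z" if h: "h \<in> I" for h
    proof -
      have hc: "h \<in> carrier G" using h assms(2) by auto
      let ?D = "\<lambda>n. (commutator G h ^^ n) a"
      have "\<exists>n. ?D n \<in> ?Z" using nil[OF h] a(1) one_Z by metis
      then have L: "?D (LEAST n. ?D n \<in> ?Z) \<in> ?Z" by (rule LeastI_ex)
      \<comment> \<open>The iterate D^m a is the last one outside \<open>?Z\<close>, so
        \<open>h\<close> stabilises it modulo \<open>?Z\<close>. As the operators commute, its
        stabiliser contains that of \<open>a\<close>, and maximality makes the two equal.\<close>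
      obtain m where m: "(LEAST n. ?D n \<in> ?Z) = Suc m" using L a(2) by (cases "LEAST n. ?D n \<in> ?Z") simp_all
      have m_out: "?D m \<notin> ?Z" using not_less_Least[of m "\<lambda>n. ?D n \<in> ?Z"] m by simp
      have m_A: "?D m \<in> A" using a(1) hc by (intro commutator_funpow_in_normal[OF A_normal])
      have "Stab a \<subseteq> Stab (?D m)"
        using commutator_funpow_commute[OF _ hc a(1)] commutator_funpow_in_normal[OF Z_norm hc]
        by (auto simp: Stab_def)
      then have "Stab (?D m) = Stab a" using a_max m_A m_out by blast
      moreover have "h \<in> Stab (?D m)" using L m hc by (simp add: Stab_def)
      ultimately show ?thesis by (simp add: Stab_def)
    qed
    then have "a \<in> annihilated I (Suc c)" using a(1) by simp
    then show False using a(2) unfolding c by simp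
  qed
  then show ?thesis using Z_A by blast
qed

lemma weakly_nilpotent_of_irreducible:
  assumes "max_normal G" "normally_irreducible G"
  shows "weakly_nilpotent UNIV G"
proof -
  \<comment> \<open>\<open>I\<close> makes no reference to the commuting family, hence neither does
    \<open>c\<close>. It may be infinite with varying nilpotency exponents, so the uniform
    \<open>c\<close> has to come from the maximal condition.\<close>
  define I where "I = {q \<in> carrier G. \<exists>a\<in>A. a \<noteq> \<one> \<and> commutator G q a = \<one>}"
  have "\<exists>n. \<forall>b\<in>A. (commutator G q ^^ n) b = \<one>" if "q \<in> I" for q
    using nilpotent_if_fixed_point[OF assms] that by (auto simp: I_def)
  then obtain c where c: "annihilated I c = A"
    using annihilated_eq_derived[OF assms(1), of I] by (auto simp: I_def)
  have "\<exists>k<2. lower_central G (H k) (Suc c) \<subseteq> {\<one>}" if fam: "commuting_family G 2 H" for H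
  proof -
    have H: "subgroup (H 0) G" "subgroup (H 1) G" using fam by (auto simp: commuting_family_def)
    have comm: "x \<otimes> y = y \<otimes> x" if "x \<in> H 0" "y \<in> H 1" for x y
      using fam that unfolding commuting_family_def by (metis one_less_numeral_iff pos2 semiring_norm(76) zero_neq_one)
    have Hc: "x \<in> carrier G" if "x \<in> H 0 \<or> x \<in> H 1" for x using that H by (meson subgroup.mem_carrier)
    show ?thesis
    proof (cases "lower_central G (H 1) 1 \<subseteq> {\<one>}")
      case True
      then have "lower_central G (H 1) (Suc c) \<subseteq> {\<one>}" using lower_central_antimono[OF H(2), of 1 "Suc c"] by simp
      then show ?thesis by (intro exI[of _ 1]) simp
    next
      case False
      then obtain a where a: "a \<in> lower_central G (H 1) 1" "a \<noteq> \<one>" by auto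
      have "a \<in> A" using a(1) lower_central_mono[of "H 1" "carrier G" 1] H(2)
        by (auto simp: derived_eq_commutator_subgroup dest: subgroup.subset)
      have "a \<in> H 1" using a(1) lower_central_antimono[OF H(2), of 0 1] by auto
      have "H 0 \<subseteq> I"
      proof
        fix x assume x: "x \<in> H 0"
        then have "commutator G x a = \<one>"
          using comm[OF x \<open>a \<in> H 1\<close>] commutator_eq_one_iff Hc \<open>a \<in> H 1\<close> by simp
        then show "x \<in> I" using x Hc a(2) \<open>a \<in> A\<close> by (auto simp: I_def)
      qed
      \<comment> \<open>One commutator leads into \<open>A\<close>, which is
        \<open>annihilated I c\<close>, and every further one lowers the index by one because
        \<open>H 0\<close> lies in \<open>I\<close>. This accounts for the class
        \<open>Suc c\<close>.\<close>
      have "lower_central G (H 0) (Suc i) \<subseteq> annihilated I (c - i)" if "i \<le> c" for i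
        using that
      proof (induction i)
        case 0
        show ?case using lower_central_mono[of "H 0" "carrier G" 1] H(1) c
          by (auto simp: derived_eq_commutator_subgroup dest: subgroup.subset)
      next
        case (Suc i)
        then obtain j where j: "c - i = Suc j" "c - Suc i = j" by (metis Suc_diff_Suc Suc_le_lessD)
        have "subgroup (annihilated I j) G"
          by (intro normal_imp_subgroup annihilated_normal) (auto simp: I_def)
        moreover have "commutator G h x \<in> annihilated I j"
          if "h \<in> H 0" "x \<in> lower_central G (H 0) (Suc i)" for h x
        proof -
          have "x \<in> annihilated I (Suc j)" using Suc that(2) j by auto
          then show ?thesis using that(1) \<open>H 0 \<subseteq> I\<close> by auto
        qed
        ultimately show ?case unfolding j lower_central.simps(2)[of G "H 0" "Suc i"]
          by (rule commutator_subgroup_least)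
      qed
      from this[of c] show ?thesis by (intro exI[of _ 0]) simp
    qed
  qed
  moreover have "(2::nat) \<ge> 1" by simp
  ultimately show ?thesis unfolding weakly_nilpotent_def by blast
qed

end

lemma (in group_hom) metabelian_img:
  assumes "metabelian G" "h ` carrier G = carrier H" shows "metabelian H"
proof -
  have "derived H (derived H (carrier H)) = h ` derived G (derived G (carrier G))"
    using derived_img[of "carrier G"] derived_img[of "derived G (carrier G)"] assms(2)
      G.derived_in_carrier[OF subset_refl] by simp
  then show ?thesis using assms(1) by (simp add: metabelian_def)
qed

lemma (in group) weakly_nilpotent_metabelian:
  assumes "metabelian G" "finitely_generated G"
  shows "weakly_nilpotent UNIV G"
proof (rule weakly_nilpotent_if_irreducible_quotients)
  show mn: "max_normal G" using assms by (rule max_normal_metabelian)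
  fix B assume B: "B \<lhd> G" "normally_irreducible (G Mod B)"
  interpret Q: group "G Mod B" using B(1) by (rule normal.factorgroup_is_group)
  interpret q: group_hom G "G Mod B" "(#>) B"
    using normal.r_coset_hom_Mod[OF B(1)] by unfold_locales
  have "metabelian (G Mod B)" using q.metabelian_img assms(1) by (simp add: carrier_FactGroup)
  then interpret Q: metabelian_group "G Mod B" by unfold_locales
  show "weakly_nilpotent UNIV (G Mod B)"
    using max_normal_epi[OF mn r_coset_epi[OF B(1)] Q.is_group] B(2) by (rule Q.weakly_nilpotent_of_irreducible)
qed simp

section \<open>Commuting subgroups of nilpotent groups\<close>

text \<open>Gaussian elimination without fractions: the vector of \<open>j\<close> clears coordinate
  \<open>i\<close> from the others after scaling them by \<open>e j i\<close>, and \<open>d\<close>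
  rewrites a relation between the cleared vectors as one between the original vectors.\<close>

lemma integer_relation:
  fixes e :: "'k \<Rightarrow> 'i \<Rightarrow> int"
  assumes "finite I" "finite K" "card I < card K"
  shows "\<exists>c. (\<exists>k\<in>K. c k \<noteq> 0) \<and> (\<forall>i\<in>I. (\<Sum>k\<in>K. c k * e k i) = 0)"
  using assms
proof (induction I arbitrary: K e rule: finite_induct)
  case empty
  then have "K \<noteq> {}" by auto
  then show ?case by (intro exI[of _ "\<lambda>_. 1"]) auto
next
  case (insert i I)
  show ?case
  proof (cases "\<forall>k\<in>K. e k i = 0")
    case True
    moreover obtain c where "\<exists>k\<in>K. c k \<noteq> 0" "\<forall>h\<in>I. (\<Sum>k\<in>K. c k * e k h) = 0"
      using insert.IH[of K e] insert.hyps insert.prems by auto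
    ultimately show ?thesis by (intro exI[of _ c]) simp
  next
    case False
    then obtain j where j: "j \<in> K" "e j i \<noteq> 0" by auto
    define K' where "K' = K - {j}"
    have K': "finite K'" "card I < card K'" using insert j by (simp_all add: K'_def)
    obtain c where c: "\<exists>k\<in>K'. c k \<noteq> 0"
      "\<And>h. h \<in> I \<Longrightarrow> (\<Sum>k\<in>K'. c k * (e j i * e k h - e k i * e j h)) = 0"
      using insert.IH[OF K', of "\<lambda>k h. e j i * e k h - e k i * e j h"] by auto
    define d where "d k = (if k = j then - (\<Sum>k\<in>K'. c k * e k i) else c k * e j i)" for k
    have "(\<Sum>k\<in>K. d k * e k h) = (\<Sum>k\<in>K'. c k * (e j i * e k h - e k i * e j h))" for h
    proof -
      have "(\<Sum>k\<in>K. d k * e k h) = d j * e j h + (\<Sum>k\<in>K'. d k * e k h)"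
        using j insert.prems(1) by (simp add: K'_def sum.remove)
      moreover have "d j * e j h = - (\<Sum>k\<in>K'. c k * e k i * e j h)"
        by (simp add: d_def sum_distrib_right)
      moreover have "(\<Sum>k\<in>K'. d k * e k h) = (\<Sum>k\<in>K'. c k * e j i * e k h)"
        by (intro sum.cong) (auto simp: d_def K'_def)
      ultimately show ?thesis by (simp add: right_diff_distrib sum_subtractf mult.assoc)
    qed
    then have "\<forall>h\<in>insert i I. (\<Sum>k\<in>K. d k * e k h) = 0" using c(2) by simp
    moreover have "\<exists>k\<in>K. d k \<noteq> 0" using c(1) j by (auto simp: d_def K'_def)
    ultimately show ?thesis by blast
  qed
qed

text \<open>Choose a nontrivial relation with least sum of absolute values. If \<open>p\<close>
  divided all coefficients, division by \<open>p\<close> would give a smaller one.\<close>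

lemma integer_relation_not_dvd:
  fixes e :: "'k \<Rightarrow> 'i \<Rightarrow> int" and p :: int
  assumes "finite I" "finite K" "card I < card K" "p > 1"
  shows "\<exists>c. (\<exists>k\<in>K. \<not> p dvd c k) \<and> (\<forall>i\<in>I. (\<Sum>k\<in>K. c k * e k i) = 0)"
proof -
  define R where "R c \<longleftrightarrow> (\<exists>k\<in>K. c k \<noteq> 0) \<and> (\<forall>i\<in>I. (\<Sum>k\<in>K. c k * e k i) = 0)" for c
  define size where "size c = (\<Sum>k\<in>K. nat \<bar>c k\<bar>)" for c :: "'k \<Rightarrow> int"
  obtain c0 where "R c0" using integer_relation[OF assms(1-3), of e] unfolding R_def by blast
  then obtain c where c: "R c" "\<And>d. R d \<Longrightarrow> size c \<le> size d" using ex_has_least_nat[of R c0 size] by blast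
  have "\<exists>k\<in>K. \<not> p dvd c k"
  proof (rule ccontr)
    assume "\<not> ?thesis"
    then have eq: "c k = p * (c k div p)" if "k \<in> K" for k using that by simp
    define d where "d k = c k div p" for k
    have "(\<Sum>k\<in>K. d k * e k i) = 0" if "i \<in> I" for i
    proof -
      have "p * (\<Sum>k\<in>K. d k * e k i) = (\<Sum>k\<in>K. c k * e k i)"
        unfolding sum_distrib_left by (intro sum.cong) (simp_all add: d_def eq[symmetric] mult.assoc[symmetric])
      then show ?thesis using c(1) that assms(4) by (simp add: R_def)
    qed
    moreover obtain k where k: "k \<in> K" "c k \<noteq> 0" using c(1) by (auto simp: R_def)
    moreover have "d k \<noteq> 0" using eq[OF k(1)] k(2) by (auto simp: d_def)
    ultimately have "R d" by (auto simp: R_def)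
    moreover have "size d < size c" unfolding size_def
    proof (rule sum_strict_mono_ex1[OF assms(2)])
      have abs_eq: "\<bar>c k\<bar> = p * \<bar>d k\<bar>" if "k \<in> K" for k
        using eq[OF that] assms(4) by (metis abs_mult abs_of_pos d_def less_trans zero_less_one)
      have abs_le: "\<bar>d k\<bar> \<le> p * \<bar>d k\<bar>" for k
        using mult_right_mono[of 1 p "\<bar>d k\<bar>"] assms(4) by simp
      show "\<forall>k\<in>K. nat \<bar>d k\<bar> \<le> nat \<bar>c k\<bar>" using abs_eq abs_le by (simp add: nat_mono)
      have "1 * \<bar>d k\<bar> < p * \<bar>d k\<bar>" using assms(4) \<open>d k \<noteq> 0\<close> by (intro mult_strict_right_mono) auto
      then show "\<exists>k\<in>K. nat \<bar>d k\<bar> < nat \<bar>c k\<bar>" using abs_eq[OF k(1)] k by (intro bexI[of _ k]) auto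
    qed
    ultimately show False using c(2)[of d] by simp
  qed
  then show ?thesis using c(1) by (auto simp: R_def)
qed

lemma (in comm_group) finprod_int_pow:
  assumes "finite S" "f \<in> S \<rightarrow> carrier G"
  shows "(\<Otimes>x\<in>S. f x) [^] (n::int) = (\<Otimes>x\<in>S. f x [^] n)"
  using assms
proof (induction S rule: finite_induct)
  case (insert a S)
  then have "f a \<in> carrier G" "f \<in> S \<rightarrow> carrier G" "(\<lambda>x. f x [^] n) \<in> S \<rightarrow> carrier G" by auto
  then show ?case using insert by (simp add: int_pow_distrib)
qed simp

text \<open>The exponent sums of a word in \<open>S\<close> that represents \<open>w\<close>. One
  vector serves all homomorphisms into \<open>W\<close>, which replaces coordinates in the
  abelianisation.\<close>

lemma (in group) hom_comm_group_exponents: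
  assumes "comm_group W" "finite S" "S \<subseteq> carrier G" "w \<in> generate G S"
  shows "\<exists>e::'a \<Rightarrow> int. \<forall>\<phi>\<in>hom G W. \<phi> w = finprod W (\<lambda>x. \<phi> x [^]\<^bsub>W\<^esub> e x) S"
proof -
  interpret W: comm_group W by fact
  have hc: "\<phi> x \<in> carrier W" if "\<phi> \<in> hom G W" "x \<in> S" for \<phi> x
    using hom_in_carrier[OF that(1)] that(2) assms(3) by auto
  have single: "finprod W (\<lambda>x. \<phi> x [^]\<^bsub>W\<^esub> (if s = x then n else 0 :: int)) S = \<phi> s [^]\<^bsub>W\<^esub> n"
    if "\<phi> \<in> hom G W" "s \<in> S" for \<phi> s n
  proof -
    have "finprod W (\<lambda>x. \<phi> x [^]\<^bsub>W\<^esub> (if s = x then n else 0 :: int)) S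
        = finprod W (\<lambda>x. if s = x then \<phi> x [^]\<^bsub>W\<^esub> n else \<one>\<^bsub>W\<^esub>) S"
      using hc[OF that(1)] by (intro W.finprod_cong') auto
    also have "\<dots> = \<phi> s [^]\<^bsub>W\<^esub> n"
      using hc[OF that(1)] that(2) assms(2) by (intro W.finprod_singleton) auto
    finally show ?thesis .
  qed
  show ?thesis using assms(4)
  proof (induction rule: generate.induct)
    case one
    have "\<phi> \<one> = \<one>\<^bsub>W\<^esub>" if "\<phi> \<in> hom G W" for \<phi> using that by (rule hom_one[OF _ is_group W.is_group])
    moreover have "finprod W (\<lambda>x. \<phi> x [^]\<^bsub>W\<^esub> (0::int)) S = \<one>\<^bsub>W\<^esub>" for \<phi> by simp
    ultimately show ?case by (intro exI[of _ "\<lambda>_. 0"] ballI) (simp only:)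
  next
    case (incl h)
    then show ?case using single[of _ h 1] hc by (intro exI[of _ "\<lambda>x. if h = x then 1 else 0"]) auto
  next
    case (inv h)
    have "\<phi> (inv h) = \<phi> h [^]\<^bsub>W\<^esub> (-1::int)" if "\<phi> \<in> hom G W" for \<phi>
    proof -
      interpret group_hom G W \<phi> using that by unfold_locales
      show ?thesis using inv assms(3) by (auto simp: W.int_pow_neg)
    qed
    then show ?case using single[of _ h "-1"] inv by (intro exI[of _ "\<lambda>x. if h = x then -1 else 0"]) auto
  next
    case (eng h1 h2)
    then obtain e1 e2 where
      e1: "\<And>\<phi>. \<phi> \<in> hom G W \<Longrightarrow> \<phi> h1 = finprod W (\<lambda>x. \<phi> x [^]\<^bsub>W\<^esub> (e1 x :: int)) S" and
      e2: "\<And>\<phi>. \<phi> \<in> hom G W \<Longrightarrow> \<phi> h2 = finprod W (\<lambda>x. \<phi> x [^]\<^bsub>W\<^esub> (e2 x :: int)) S" by blast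
    have "\<phi> (h1 \<otimes> h2) = finprod W (\<lambda>x. \<phi> x [^]\<^bsub>W\<^esub> (e1 x + e2 x)) S" if "\<phi> \<in> hom G W" for \<phi>
    proof -
      have "\<phi> (h1 \<otimes> h2) = \<phi> h1 \<otimes>\<^bsub>W\<^esub> \<phi> h2"
        using that eng(1,2) generate_in_carrier[OF assms(3)] by (intro hom_mult)
      also have "\<dots> = finprod W (\<lambda>x. \<phi> x [^]\<^bsub>W\<^esub> e1 x \<otimes>\<^bsub>W\<^esub> \<phi> x [^]\<^bsub>W\<^esub> e2 x) S"
        unfolding e1[OF that] e2[OF that] using hc[OF that] by (intro W.finprod_multf[symmetric]) auto
      also have "\<dots> = finprod W (\<lambda>x. \<phi> x [^]\<^bsub>W\<^esub> (e1 x + e2 x)) S"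
        using hc[OF that] by (intro W.finprod_cong') (auto simp: W.int_pow_mult)
      finally show ?thesis .
    qed
    then show ?case by (intro exI[of _ "\<lambda>x. e1 x + e2 x"]) simp
  qed
qed

text \<open>Otherwise choose a prime \<open>p\<close> dividing the order of \<open>b\<close> (any prime if \<open>b\<close> has infinite order, where
  \<open>ord b = 0\<close>); an integer relation between the exponent vectors of the \<open>w k\<close> with a coefficient prime to
  \<open>p\<close> contradicts the values of the \<open>\<phi> l\<close>.\<close>
lemma (in group) diagonal_hom_values:
  assumes "comm_group W" "finite S" "S \<subseteq> carrier G" "generate G S = carrier G"
    and N: "card S < N" and w: "\<And>k. k < N \<Longrightarrow> w k \<in> carrier G"
    and \<phi>: "\<And>l. l < N \<Longrightarrow> \<phi> l \<in> hom G W"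
    and b: "b \<in> carrier W"
    and val: "\<And>k l. \<lbrakk>k < N; l < N\<rbrakk> \<Longrightarrow> \<phi> l (w k) = (if l = k then b else \<one>\<^bsub>W\<^esub>)"
  shows "b = \<one>\<^bsub>W\<^esub>"
proof (rule ccontr)
  interpret W: comm_group W by fact
  assume "b \<noteq> \<one>\<^bsub>W\<^esub>"
  then have "W.ord b \<noteq> 1" using W.ord_eq_1[OF b] by simp
  then obtain p where p: "Factorial_Ring.prime p" "p dvd W.ord b" using prime_factor_nat by blast
  have "\<forall>k<N. \<exists>e::'a \<Rightarrow> int. \<forall>\<psi>\<in>hom G W. \<psi> (w k) = finprod W (\<lambda>x. \<psi> x [^]\<^bsub>W\<^esub> e x) S"
    using hom_comm_group_exponents[OF assms(1-3)] w assms(4) by simp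
  then obtain e :: "nat \<Rightarrow> 'a \<Rightarrow> int" where
    e: "\<And>k \<psi>. \<lbrakk>k < N; \<psi> \<in> hom G W\<rbrakk> \<Longrightarrow> \<psi> (w k) = finprod W (\<lambda>x. \<psi> x [^]\<^bsub>W\<^esub> e k x) S"
    by metis
  have "int p > 1" using p(1) prime_gt_1_nat by simp
  then obtain c where c: "\<exists>k<N. \<not> int p dvd c k" "\<And>x. x \<in> S \<Longrightarrow> (\<Sum>k<N. c k * e k x) = 0"
    using integer_relation_not_dvd[of S "{..<N}" "int p" e] assms(2) N by auto
  have "int p dvd c l" if l: "l < N" for l
  proof -
    have hc: "\<phi> l x \<in> carrier W" if "x \<in> S" for x using hom_in_carrier[OF \<phi>[OF l]] that assms(3) by auto
    \<comment> \<open>The product over k of the powers \<phi>_l(w_k)^(c_k) is evaluated twice: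
      collected by generators it is trivial by the relation, while by \<open>val\<close> it is
      b^(c_l). So the order of \<open>b\<close> divides every coefficient.\<close>
    have "finprod W (\<lambda>k. \<phi> l (w k) [^]\<^bsub>W\<^esub> c k) {..<n}
        = finprod W (\<lambda>x. \<phi> l x [^]\<^bsub>W\<^esub> (\<Sum>k<n. c k * e k x)) S" if "n \<le> N" for n
      using that
    proof (induction n)
      case 0
      show ?case by simp
    next
      case (Suc n)
      have "\<phi> l (w n) [^]\<^bsub>W\<^esub> c n = finprod W (\<lambda>x. (\<phi> l x [^]\<^bsub>W\<^esub> e n x) [^]\<^bsub>W\<^esub> c n) S"
        using e[of n "\<phi> l"] \<phi>[OF l] Suc.prems hc by (simp add: W.finprod_int_pow[OF assms(2)])
      also have "\<dots> = finprod W (\<lambda>x. \<phi> l x [^]\<^bsub>W\<^esub> (c n * e n x)) S"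
        using hc by (intro W.finprod_cong') (auto simp: W.int_pow_pow mult.commute)
      finally have "\<phi> l (w n) [^]\<^bsub>W\<^esub> c n = finprod W (\<lambda>x. \<phi> l x [^]\<^bsub>W\<^esub> (c n * e n x)) S" .
      moreover have "\<phi> l (w k) \<in> carrier W" if "k \<le> n" for k
        using hom_in_carrier[OF \<phi>[OF l] w] that Suc.prems by simp
      moreover have "finprod W (\<lambda>x. \<phi> l x [^]\<^bsub>W\<^esub> (c n * e n x)) S \<in> carrier W"
        using hc by (intro W.finprod_closed) auto
      ultimately have "finprod W (\<lambda>k. \<phi> l (w k) [^]\<^bsub>W\<^esub> c k) {..<Suc n}
          = finprod W (\<lambda>x. \<phi> l x [^]\<^bsub>W\<^esub> (c n * e n x)) S
            \<otimes>\<^bsub>W\<^esub> finprod W (\<lambda>x. \<phi> l x [^]\<^bsub>W\<^esub> (\<Sum>k<n. c k * e k x)) S"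
        using Suc by (subst lessThan_Suc, subst W.finprod_insert) (auto simp: Pi_def)
      also have "\<dots> = finprod W (\<lambda>x. \<phi> l x [^]\<^bsub>W\<^esub> (c n * e n x)
            \<otimes>\<^bsub>W\<^esub> \<phi> l x [^]\<^bsub>W\<^esub> (\<Sum>k<n. c k * e k x)) S"
        using hc by (intro W.finprod_multf[symmetric]) auto
      also have "\<dots> = finprod W (\<lambda>x. \<phi> l x [^]\<^bsub>W\<^esub> (\<Sum>k<Suc n. c k * e k x)) S"
        using hc by (intro W.finprod_cong') (auto simp: W.int_pow_mult add.commute)
      finally show ?case .
    qed
    from this[of N] have "finprod W (\<lambda>k. \<phi> l (w k) [^]\<^bsub>W\<^esub> c k) {..<N}
        = finprod W (\<lambda>x. \<phi> l x [^]\<^bsub>W\<^esub> (\<Sum>k<N. c k * e k x)) S" by simp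
    also have "\<dots> = \<one>\<^bsub>W\<^esub>" using c(2) by (intro W.finprod_one_eqI) simp
    also have "finprod W (\<lambda>k. \<phi> l (w k) [^]\<^bsub>W\<^esub> c k) {..<N}
        = finprod W (\<lambda>k. if l = k then b [^]\<^bsub>W\<^esub> c k else \<one>\<^bsub>W\<^esub>) {..<N}"
      using val[OF _ l] b by (intro W.finprod_cong') auto
    also have "\<dots> = b [^]\<^bsub>W\<^esub> c l" using l b by (intro W.finprod_singleton) auto
    finally have "int (W.ord b) dvd c l" using W.int_pow_eq_id[OF b] by simp
    then show ?thesis using p(2) by (meson dvd_trans of_nat_dvd_iff)
  qed
  then show False using c(1) by blast
qed

context group
begin

lemma irreducible_common_element:
  fixes n :: nat
  assumes "normally_irreducible G" "\<And>k. k \<le> n \<Longrightarrow> B k \<lhd> G" "\<And>k. k \<le> n \<Longrightarrow> B k \<noteq> {\<one>}"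
  shows "\<exists>b. b \<noteq> \<one> \<and> (\<forall>k\<le>n. b \<in> B k)"
proof -
  have "(\<Inter>k\<le>n. B k) \<lhd> G \<and> (\<Inter>k\<le>n. B k) \<noteq> {\<one>}"
    using assms(2,3)
  proof (induction n)
    case 0
    then show ?case by simp
  next
    case (Suc n)
    have IH: "(\<Inter>k\<le>n. B k) \<lhd> G" "(\<Inter>k\<le>n. B k) \<noteq> {\<one>}" using Suc by auto
    have B: "B (Suc n) \<lhd> G" "B (Suc n) \<noteq> {\<one>}" using Suc.prems by auto
    have "B (Suc n) \<inter> (\<Inter>k\<le>n. B k) \<lhd> G" using B(1) IH(1) by (rule normal_subgroup_intersect)
    moreover have "B (Suc n) \<inter> (\<Inter>k\<le>n. B k) \<noteq> {\<one>}"
      using assms(1) B IH unfolding normally_irreducible_def by metis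
    moreover have "(\<Inter>k\<le>Suc n. B k) = B (Suc n) \<inter> (\<Inter>k\<le>n. B k)" by (simp add: atMost_Suc)
    ultimately show ?case by (simp only: simp_thms)
  qed
  moreover from this have "\<one> \<in> (\<Inter>k\<le>n. B k)" by (meson normal_imp_subgroup subgroup.one_closed)
  ultimately show ?thesis by blast
qed

lemma weakly_nilpotent_of_irreducible_nilpotent:
  assumes "normally_irreducible G" "finitely_generated G"
    and nil: "lower_central G (carrier G) (Suc (Suc d)) \<subseteq> {\<one>}"
  shows "weakly_nilpotent {Suc d} G"
proof -
  obtain S where S: "finite S" "S \<subseteq> carrier G" "generate G S = carrier G"
    using assms(2) by (auto simp: finitely_generated_def)
  define Z where "Z = lower_central G (carrier G) (Suc d)"
  define W where "W = G\<lparr>carrier := Z\<rparr>"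
  have Z_sub: "subgroup Z G" unfolding Z_def by (rule lower_central_is_subgroup[OF subgroup_self])
  then have Zc: "z \<in> carrier G" if "z \<in> Z" for z using that by (rule subgroup.mem_carrier)
  have central: "g \<otimes> z = z \<otimes> g" if "g \<in> carrier G" "z \<in> Z" for g z
  proof -
    have "commutator G g z \<in> lower_central G (carrier G) (Suc (Suc d))"
      using commutator_in_commutator_subgroup[OF that(1), of z Z] that(2) by (simp add: Z_def)
    then have "commutator G g z = \<one>" using nil by auto
    then show ?thesis using commutator_eq_one_iff[OF that(1) Zc[OF that(2)]] by simp
  qed
  have "group W" unfolding W_def using Z_sub by (rule subgroup.subgroup_is_group) (rule is_group)
  then have W: "comm_group W"
    by (rule group.group_comm_groupI) (simp add: W_def central Zc)
  have hom: "(\<lambda>g. commutator G g v) \<in> hom G W" if v: "v \<in> lower_central G (carrier G) d" for v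
  proof (rule homI)
    have vc: "v \<in> carrier G"
      using v lower_central_is_subgroup[OF subgroup_self] by (meson subgroup.mem_carrier)
    have mem: "commutator G g v \<in> Z" if "g \<in> carrier G" for g
      using commutator_in_commutator_subgroup[OF that v] by (simp add: Z_def)
    then show "commutator G g v \<in> carrier W" if "g \<in> carrier G" for g using that by (simp add: W_def)
    fix g h assume gh: "g \<in> carrier G" "h \<in> carrier G"
    have "commutator G (g \<otimes> h) v = (g \<otimes> commutator G h v \<otimes> inv g) \<otimes> commutator G g v"
      using gh vc by (simp add: commutator_def inv_mult_group m_assoc)
    also have "\<dots> = commutator G h v \<otimes> commutator G g v"
      using gh vc mem[OF gh(2)] central[OF gh(1) mem[OF gh(2)]] by (simp add: m_assoc)
    also have "\<dots> = commutator G g v \<otimes> commutator G h v" using central mem gh Zc by simp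
    finally show "commutator G (g \<otimes> h) v = commutator G g v \<otimes>\<^bsub>W\<^esub> commutator G h v" by (simp add: W_def)
  qed
  \<comment> \<open>With \<open>Suc n\<close> subgroups there are more elements \<open>w k\<close>
    than generators, as the integer relation requires.\<close>
  define n where "n = card S"
  have "\<exists>k<Suc n. lower_central G (H k) (Suc d) \<subseteq> {\<one>}" if fam: "commuting_family G (Suc n) H" for H
  proof (rule ccontr)
    assume bad: "\<not> ?thesis"
    have H: "subgroup (H k) G" if "k \<le> n" for k using fam that by (simp add: commuting_family_def)
    then have Hc: "x \<in> carrier G" if "k \<le> n" "x \<in> H k" for k x using that by (meson subgroup.mem_carrier)
    have "\<exists>u\<in>H k. \<exists>v\<in>lower_central G (H k) d. commutator G u v \<noteq> \<one>" if "k \<le> n" for k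
    proof (rule ccontr)
      assume "\<not> ?thesis"
      then have "lower_central G (H k) (Suc d) \<subseteq> {\<one>}"
        using commutator_subgroup_least[OF triv_subgroup, of "H k" "lower_central G (H k) d"] by auto
      then show False using bad that by auto
    qed
    then obtain u v where uv: "\<And>k. k \<le> n \<Longrightarrow> u k \<in> H k" "\<And>k. k \<le> n \<Longrightarrow> v k \<in> lower_central G (H k) d"
      "\<And>k. k \<le> n \<Longrightarrow> commutator G (u k) (v k) \<noteq> \<one>" by metis
    have vH: "v k \<in> H k" if "k \<le> n" for k
      using uv(2)[OF that] lower_central_antimono[OF H[OF that], of 0 d] by auto
    have vG: "v k \<in> lower_central G (carrier G) d" if "k \<le> n" for k
      using uv(2)[OF that] lower_central_mono[of "H k" "carrier G" d] Hc[OF that] by auto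
    define a where "a k = commutator G (u k) (v k)" for k
    have aZ: "a k \<in> Z" if "k \<le> n" for k
      using hom_in_carrier[OF hom[OF vG[OF that]] Hc[OF that uv(1)[OF that]]] by (simp add: a_def W_def)
    \<comment> \<open>Each \<open>a k\<close> is central, so already its cyclic subgroup is normal;
      an element common to all of them is a power of every \<open>a k\<close>.\<close>
    have "generate G {a k} \<lhd> G" if "k \<le> n" for k
    proof (rule normal_generateI)
      show "{a k} \<subseteq> carrier G" using Zc[OF aZ[OF that]] by simp
      show "g \<otimes> h \<otimes> inv g \<in> {a k}" if "h \<in> {a k}" "g \<in> carrier G" for h g
        using that central[OF that(2) aZ[OF \<open>k \<le> n\<close>]] Zc[OF aZ[OF \<open>k \<le> n\<close>]] by (simp add: m_assoc)
    qed
    moreover have "generate G {a k} \<noteq> {\<one>}" if "k \<le> n" for k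
      using uv(3)[OF that] generate.incl[of "a k" "{a k}" G] by (auto simp: a_def)
    ultimately obtain b where b: "b \<noteq> \<one>" "\<And>k. k \<le> n \<Longrightarrow> b \<in> generate G {a k}"
      using irreducible_common_element[OF assms(1), of n "\<lambda>k. generate G {a k}"] by auto
    have "\<exists>m::int. b = a k [^] m" if "k \<le> n" for k
      using b(2)[OF that] generate_pow[OF Zc[OF aZ[OF that]]] by auto
    then obtain m :: "nat \<Rightarrow> int" where m: "\<And>k. k \<le> n \<Longrightarrow> b = a k [^] m k" by metis
    \<comment> \<open>Since [., v_k] is a homomorphism, raising \<open>u k\<close> to the power
      \<open>m k\<close> turns the value \<open>a k\<close> into the common \<open>b\<close>,
      without leaving \<open>H k\<close>.\<close>
    define w where "w k = u k [^] m k" for k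
    have wH: "w k \<in> H k" if "k \<le> n" for k
      unfolding w_def using subgroup_int_pow_closed[OF H[OF that] uv(1)[OF that]] .
    have "b \<in> Z" using m[of 0] subgroup_int_pow_closed[OF Z_sub aZ[of 0]] by simp
    have diag: "commutator G (w k) (v k) = b" if "k \<le> n" for k
    proof -
      interpret h: group_hom G W "\<lambda>g. commutator G g (v k)"
        using hom[OF vG[OF that]] \<open>group W\<close> by (simp add: group_hom_def group_hom_axioms_def)
      have "commutator G (w k) (v k) = a k [^]\<^bsub>W\<^esub> m k"
        unfolding w_def a_def using h.hom_int_pow[OF Hc[OF that uv(1)[OF that]]] .
      also have "\<dots> = b" using int_pow_consistent[OF Z_sub aZ[OF that]] m[OF that] by (simp add: W_def)
      finally show ?thesis .
    qed
    have off: "commutator G (w k) (v l) = \<one>" if "k \<le> n" "l \<le> n" "l \<noteq> k" for k l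
    proof -
      have "w k \<otimes> v l = v l \<otimes> w k"
        using commuting_familyD[OF fam _ _ _ wH[OF that(1)] vH[OF that(2)]] that by simp
      then show ?thesis
        using commutator_eq_one_iff[OF Hc[OF that(1) wH[OF that(1)]] Hc[OF that(2) vH[OF that(2)]]] by simp
    qed
    have "b = \<one>\<^bsub>W\<^esub>"
    proof (rule diagonal_hom_values[OF W S, of "Suc n" w "\<lambda>l g. commutator G g (v l)"])
      show "card S < Suc n" by (simp add: n_def)
      show "w k \<in> carrier G" if "k < Suc n" for k using Hc[OF _ wH] that by simp
      show "(\<lambda>g. commutator G g (v l)) \<in> hom G W" if "l < Suc n" for l using hom vG that by simp
      show "b \<in> carrier W" using \<open>b \<in> Z\<close> by (simp add: W_def)
      show "commutator G (w k) (v l) = (if l = k then b else \<one>\<^bsub>W\<^esub>)" if "k < Suc n" "l < Suc n" for k l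
        using that diag off by (simp add: W_def)
    qed
    then show False using b(1) by (simp add: W_def)
  qed
  moreover have "Suc n \<ge> 1" by simp
  ultimately show ?thesis unfolding weakly_nilpotent_def by blast
qed

lemma weakly_nilpotent_nilpotent:
  assumes "metabelian G" "finitely_generated G" "lower_central G (carrier G) (Suc (Suc d)) \<subseteq> {\<one>}"
  shows "weakly_nilpotent {Suc d} G"
proof (rule weakly_nilpotent_if_irreducible_quotients)
  show "max_normal G" using assms(1,2) by (rule max_normal_metabelian)
  fix B assume B: "B \<lhd> G" "normally_irreducible (G Mod B)"
  interpret Q: group "G Mod B" using B(1) by (rule normal.factorgroup_is_group)
  interpret q: group_hom G "G Mod B" "(#>) B"
    using normal.r_coset_hom_Mod[OF B(1)] by unfold_locales
  have "lower_central (G Mod B) (carrier (G Mod B)) (Suc (Suc d)) = (#>) B ` lower_central G (carrier G) (Suc (Suc d))"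
    using q.lower_central_img[OF subgroup_self, of "Suc (Suc d)"] by (simp only: carrier_FactGroup)
  also have "\<dots> \<subseteq> {\<one>\<^bsub>G Mod B\<^esub>}" using assms(3) q.hom_one by auto
  finally have "lower_central (G Mod B) (carrier (G Mod B)) (Suc (Suc d)) \<subseteq> {\<one>\<^bsub>G Mod B\<^esub>}" .
  with B(2) finitely_generated_epi[OF r_coset_epi[OF B(1)] Q.is_group assms(2)]
  show "weakly_nilpotent {Suc d} (G Mod B)" by (rule Q.weakly_nilpotent_of_irreducible_nilpotent)
qed simp

end

section \<open>Weak identities\<close>

lemma incl_hom: "incl N k \<in> hom FreeGroup (FPow N)"
  by (rule homI) (auto simp: FPow_def incl_def FreeGroup_def fun_eq_iff)

lemma incl_commute:
  assumes "k \<noteq> l" "x \<in> carrier FreeGroup" "y \<in> carrier FreeGroup"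
  shows "incl N k x \<otimes>\<^bsub>FPow N\<^esub> incl N l y = incl N l y \<otimes>\<^bsub>FPow N\<^esub> incl N k x"
  using assms by (auto simp: FPow_def incl_def FreeGroup_def fun_eq_iff)

text \<open>In the usual numbering \<gamma>_{n+1}(F)F'', the laws of metabelian groups of class at
  most \<open>n\<close>.\<close>

definition nilpotent_metabelian_words :: "nat \<Rightarrow> fword set" where
  "nilpotent_metabelian_words n = generate FreeGroup (lower_central FreeGroup (carrier FreeGroup) n
     \<union> derived FreeGroup (derived FreeGroup (carrier FreeGroup)))"

lemma T_subgroup_derived: "T_subgroup H \<Longrightarrow> T_subgroup (derived FreeGroup H)"
  by (simp add: derived_eq_commutator_subgroup T_subgroup_commutator_subgroup)

lemma T_subgroup_words: "T_subgroup (nilpotent_metabelian_words n)"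
  unfolding nilpotent_metabelian_words_def
  by (intro T_subgroup_join T_subgroup_lower_central T_subgroup_derived T_subgroup_carrier)

text \<open>The images of the factors form a commuting family. On a factor with small image the
  homomorphism kills the lower central term, and it kills F'' since \<open>G\<close> is metabelian,
  so it kills all the words at once; the index k depends on \<open>\<rho>\<close> only, not on the
  chosen words.\<close>

lemma weak_identities_if_weakly_nilpotent:
  assumes "group G" "metabelian G" "weakly_nilpotent {c} G"
  shows "weak_identities (nilpotent_metabelian_words c) G"
proof -
  interpret group G by fact
  obtain N where N: "N \<ge> 1"
    "\<And>H. commuting_family G N H \<Longrightarrow> \<exists>k<N. lower_central G (H k) c \<subseteq> {\<one>\<^bsub>G\<^esub>}"
    using assms(3) unfolding weakly_nilpotent_def by blast
  have "\<exists>k<N. \<rho> (incl N k (s k)) = \<one>\<^bsub>G\<^esub>"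
    if s: "s \<in> {..<N} \<rightarrow> nilpotent_metabelian_words c" and \<rho>: "\<rho> \<in> hom (FPow N) G" for s \<rho>
  proof -
    define \<sigma> where "\<sigma> k = \<rho> \<circ> incl N k" for k
    define H where "H k = \<sigma> k ` carrier FreeGroup" for k
    have \<sigma>: "\<sigma> k \<in> hom FreeGroup G" for k
      unfolding \<sigma>_def using incl_hom \<rho> by (rule Group.hom_compose)
    then have gh: "group_hom FreeGroup G (\<sigma> k)" for k
      by (simp add: group_hom_def group_hom_axioms_def group_FreeGroup is_group)
    have "x \<otimes>\<^bsub>G\<^esub> y = y \<otimes>\<^bsub>G\<^esub> x" if kl: "k \<noteq> l" and "x \<in> H k" "y \<in> H l" for k l x y
    proof -
      obtain x' y' where xy: "x' \<in> carrier FreeGroup" "y' \<in> carrier FreeGroup"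
        "x = \<rho> (incl N k x')" "y = \<rho> (incl N l y')"
        using \<open>x \<in> H k\<close> \<open>y \<in> H l\<close> by (auto simp: H_def \<sigma>_def)
      have c: "incl N k x' \<in> carrier (FPow N)" "incl N l y' \<in> carrier (FPow N)"
        using xy(1,2) incl_hom hom_in_carrier by metis+
      show ?thesis
        unfolding xy(3,4) hom_mult[OF \<rho> c, symmetric] hom_mult[OF \<rho> c(2,1), symmetric]
        by (simp only: incl_commute[OF kl xy(1,2)])
    qed
    moreover have Hsub: "subgroup (H k) G" for k unfolding H_def using gh by (rule group_hom.img_is_subgroup)
    ultimately have "commuting_family G N H" unfolding commuting_family_def by blast
    then obtain k where k: "k < N" "lower_central G (H k) c \<subseteq> {\<one>\<^bsub>G\<^esub>}" using N(2) by blast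
    interpret h: group_hom FreeGroup G "\<sigma> k" by (rule gh)
    have img: "\<sigma> k ` carrier FreeGroup = H k" by (simp add: H_def)
    have "\<sigma> k ` lower_central FreeGroup (carrier FreeGroup) c \<subseteq> {\<one>\<^bsub>G\<^esub>}"
      using k(2) h.lower_central_img[OF F.subgroup_self] by (simp add: img)
    moreover have "\<sigma> k ` derived FreeGroup (derived FreeGroup (carrier FreeGroup)) \<subseteq> {\<one>\<^bsub>G\<^esub>}"
    proof -
      have "\<sigma> k ` derived FreeGroup (derived FreeGroup (carrier FreeGroup)) = derived G (derived G (H k))"
        using h.derived_img[of "carrier FreeGroup"] h.derived_img[of "derived FreeGroup (carrier FreeGroup)"]
          F.derived_in_carrier[OF subset_refl] img by simp
      also have "\<dots> \<subseteq> derived G (derived G (carrier G))"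
        using subgroup.subset[OF Hsub] by (intro mono_derived)
      finally show ?thesis using assms(2) by (simp add: metabelian_def)
    qed
    moreover have "lower_central FreeGroup (carrier FreeGroup) c \<subseteq> carrier FreeGroup"
      "derived FreeGroup (derived FreeGroup (carrier FreeGroup)) \<subseteq> carrier FreeGroup"
      using F.lower_central_is_subgroup[OF F.subgroup_self] F.derived_in_carrier
      by (auto dest: subgroup.subset)
    ultimately have "\<sigma> k ` nilpotent_metabelian_words c \<subseteq> {\<one>\<^bsub>G\<^esub>}"
      unfolding nilpotent_metabelian_words_def
      by (subst h.generate_img[symmetric], simp, intro generate_subgroup_incl[OF _ triv_subgroup])
        (simp only: image_Un Un_subset_iff)
    moreover have "s k \<in> nilpotent_metabelian_words c" using s k(1) by auto
    ultimately have "\<rho> (incl N k (s k)) = \<one>\<^bsub>G\<^esub>" by (auto simp: \<sigma>_def)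
    then show ?thesis using k(1) by blast
  qed
  then show ?thesis unfolding weak_identities_def using N(1) by blast
qed

lemma quotient_verbal:
  assumes "group G" "finitely_generated G" "T_subgroup V"
    and F2: "derived FreeGroup (derived FreeGroup (carrier FreeGroup)) \<subseteq> V"
  shows "group (G Mod verbal V G)" "metabelian (G Mod verbal V G)" "finitely_generated (G Mod verbal V G)"
    and "lower_central FreeGroup (carrier FreeGroup) n \<subseteq> V \<Longrightarrow>
      lower_central (G Mod verbal V G) (carrier (G Mod verbal V G)) n \<subseteq> {\<one>\<^bsub>G Mod verbal V G\<^esub>}"
proof -
  interpret group G by fact
  let ?Q = "G Mod verbal V G"
  have N: "verbal V G \<lhd> G" using assms(3) by (rule verbal_normal)
  then show Q: "group ?Q" by (rule normal.factorgroup_is_group)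
  then interpret Q: group ?Q .
  interpret q: group_hom G ?Q "r_coset G (verbal V G)"
    using normal.r_coset_hom_Mod[OF N] by unfold_locales
  show "finitely_generated ?Q" using finitely_generated_epi[OF r_coset_epi[OF N] Q assms(2)] .
  have surj: "r_coset G (verbal V G) ` carrier G = carrier ?Q" by (simp add: carrier_FactGroup)
  have triv: "r_coset G (verbal V G) ` K \<subseteq> {\<one>\<^bsub>?Q\<^esub>}" if "K \<subseteq> verbal V G" for K
    using that coset_join2[OF _ normal_imp_subgroup[OF N]] subgroup.subset[OF normal_imp_subgroup[OF N]]
    by (auto simp: subset_iff)
  have "derived ?Q (derived ?Q (carrier ?Q)) = r_coset G (verbal V G) ` derived G (derived G (carrier G))"
    using q.derived_img[of "carrier G"] q.derived_img[of "derived G (carrier G)"] surj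
      derived_in_carrier[OF subset_refl] by simp
  also have "\<dots> \<subseteq> {\<one>\<^bsub>?Q\<^esub>}"
    using derived_derived_subset_verbal verbal_mono[OF F2, of G] by (intro triv) blast
  finally show "metabelian ?Q" by (rule Q.metabelianI)
  assume "lower_central FreeGroup (carrier FreeGroup) n \<subseteq> V"
  then have "lower_central G (carrier G) n \<subseteq> verbal V G"
    using lower_central_subset_verbal[of n] verbal_mono[of _ V G] by blast
  then show "lower_central ?Q (carrier ?Q) n \<subseteq> {\<one>\<^bsub>?Q\<^esub>}"
    using triv[of "lower_central G (carrier G) n"] q.lower_central_img[OF subgroup_self, of n]
    by (simp only: surj)
qed

theorem theorem5p1:
  fixes G :: "('g, 'b) monoid_scheme"
  assumes "group G" and "finitely_generated G"
  shows "weak_star_mod (derived FreeGroup (carrier FreeGroup))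
           (derived FreeGroup (derived FreeGroup (carrier FreeGroup))) G"
proof -
  let ?F1 = "derived FreeGroup (carrier FreeGroup)"
  let ?F2 = "derived FreeGroup ?F1"
  let ?W = nilpotent_metabelian_words
  have T1: "T_subgroup ?F1" and T2: "T_subgroup ?F2"
    by (intro T_subgroup_derived T_subgroup_carrier)+
  note Q2 = quotient_verbal[OF assms T2 subset_refl]
  obtain N c where N: "N \<ge> 1" and Nc: "\<And>H. commuting_family (G Mod verbal ?F2 G) N H \<Longrightarrow>
      \<exists>k<N. lower_central (G Mod verbal ?F2 G) (H k) c \<subseteq> {\<one>\<^bsub>G Mod verbal ?F2 G\<^esub>}"
    using group.weakly_nilpotent_metabelian[OF Q2(1-3)] unfolding weakly_nilpotent_def by blast
  \<comment> \<open>Raising the class by one keeps the index positive even if \<open>c\<close> is 0,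
    so that it is reached by a chain that starts with F' at index 1.\<close>
  have "\<exists>k<N. lower_central (G Mod verbal ?F2 G) (H k) (Suc c) \<subseteq> {\<one>\<^bsub>G Mod verbal ?F2 G\<^esub>}"
    if H: "commuting_family (G Mod verbal ?F2 G) N H" for H
  proof -
    obtain k where "k < N" "lower_central (G Mod verbal ?F2 G) (H k) c \<subseteq> {\<one>\<^bsub>G Mod verbal ?F2 G\<^esub>}"
      using Nc[OF H] by blast
    moreover from this have "subgroup (H k) (G Mod verbal ?F2 G)"
      using H by (simp add: commuting_family_def)
    ultimately show ?thesis using group.lower_central_Suc_subset[OF Q2(1)] by blast
  qed
  then have "weakly_nilpotent {Suc c} (G Mod verbal ?F2 G)"
    unfolding weakly_nilpotent_def using N by blast
  then have top: "weak_identities_mod (?W (Suc c)) ?F2 G"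
    unfolding weak_identities_mod_def by (rule weak_identities_if_weakly_nilpotent[OF Q2(1,2)])
  \<comment> \<open>The target contains the lower central term with index
    \<open>Suc (Suc d)\<close>, which therefore vanishes in the quotient, as the nilpotent stage
    requires.\<close>
  have step: "weak_identities_mod (?W (Suc d)) (?W (Suc (Suc d))) G" for d
  proof -
    have sub: "?F2 \<subseteq> ?W (Suc (Suc d))" "lower_central FreeGroup (carrier FreeGroup) (Suc (Suc d)) \<subseteq> ?W (Suc (Suc d))"
      unfolding nilpotent_metabelian_words_def by (auto intro: generate.incl)
    note Q = quotient_verbal[OF assms T_subgroup_words sub(1)]
    show ?thesis
      unfolding weak_identities_mod_def
      using weak_identities_if_weakly_nilpotent[OF Q(1,2) group.weakly_nilpotent_nilpotent[OF Q(1-3) Q(4)[OF sub(2)]]] .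
  qed
  have F1: "?W (Suc 0) = ?F1"
  proof -
    have "?F2 \<subseteq> ?F1"
      using F.derived_incl[OF subset_refl, of ?F1] T1 by (simp add: T_subgroup_def)
    then have "?W (Suc 0) = generate FreeGroup ?F1"
      unfolding nilpotent_metabelian_words_def lower_central_1 by (simp add: Un_absorb2)
    also have "\<dots> = ?F1"
      using F.generateI[of ?F1 ?F1] T1 by (simp add: T_subgroup_def)
    finally show ?thesis .
  qed
  \<comment> \<open>The shift by one starts the chain at F'. Its last entry is F'' itself in place
    of the next group of words.\<close>
  define Ss where "Ss j = (if j = Suc c then ?F2 else ?W (Suc j))" for j
  show ?thesis
    unfolding weak_star_mod_def
  proof (intro exI[of _ "Suc c"] exI[of _ Ss] conjI ballI allI impI)
    show "Ss 0 = ?F1" using F1 by (simp add: Ss_def)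
    show "Ss (Suc c) = ?F2" by (simp add: Ss_def)
    show "T_subgroup (Ss j)" for j using T2 T_subgroup_words by (simp add: Ss_def)
    fix j assume "j \<in> {1..Suc c}"
    then obtain d where "j = Suc d" "d \<le> c" by (cases j) auto
    then show "weak_identities_mod (Ss (j - 1)) (Ss j) G" using top step[of d] by (auto simp: Ss_def)
  qed
qed
end
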